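(* Let $1<\beta\le2$, let $K,L,T>0$, let $M,N,J$ be positive integers, and let $G_i^n$ ($1\le i\le M-1$, $1\le n\le N$) and $\phi_i$ ($1\le i\le M-1$) be real numbers. Let $\{u_i^n : 0\le i\le M,\ 0\le n\le N\}$ be the solution of the difference system $$\Delta\alpha\sum_{l=0}^{2J}c_l\,\omega(\alpha_l)\frac{1}{\tau^{\gamma_l}}\sum_{k=0}^{n-1}\lambda_k^{(\gamma_l)}\delta_tu_i^{n-k-\frac12}=-Kh^{-\beta}\sum_{k=i-M}^{i}\hat g_k^{(\beta)}u_{i-k}^{n-\frac12}+G_i^{n},\quad 1\le i\le M-1,\ 1\le n\le N,$$ $$u_i^0=\phi_i,\quad 1\le i\le M-1,\qquad u_0^n=0,\ u_M^n=0,\quad 0\le n\le N.$$ Then for every $1\le m\le N$, $$\|u^m\|^2\le \exp(T)\Bigg[\frac{3L^\beta}{c_*^{(\beta)}}\,|u^0|_{H^{\beta/2}}^2+\left(\frac{2L^\beta}{Kc_*^{(\beta)}}\right)^2\Big(\|G^1\|^2+\max_{1\le n\le m}\|G^n\|^2\Big)+\left(\frac{2L^\beta}{Kc_*^{(\beta)}}\right)^2\tau\sum_{n=1}^{m-1}\|\delta_tG^{n+\frac12}\|^2\Bigg],$$ where $\|G^n\|^2=h\sum_{i=1}^{M-1}(G_i^n)^2$ and $\|\delta_tG^{n+\frac12}\|^2=h\sum_{i=1}^{M-1}(\delta_tG_i^{n+\frac12})^2$.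
   Context: Grid: $h=L/M$, $\tau=T/N$, $x_i=ih$, $t_n=n\tau$. $u_i^{n-\frac12}=\frac12(u_i^n+u_i^{n-1})$, $\delta_tu_i^{n-\frac12}=\frac1\tau(u_i^n-u_i^{n-1})$, and likewise $\delta_tG_i^{n+\frac12}=\frac1\tau(G_i^{n+1}-G_i^n)$. For a grid function $v=(v_0,\dots,v_M)$ with $v_0=v_M=0$, $\|v\|^2=h\sum_{i=1}^{M-1}v_i^2$. Weight function: $\omega:[1,2]\to\mathbb R$ satisfies $\omega(\alpha)\ge0$ and $\omega(\alpha)\neq0$ for $\alpha\in[1,2]$, and $0<\int_1^2\omega(\alpha)\,d\alpha<\infty$. Distributed-order quadrature: $\Delta\alpha=\frac1{2J}$, $\alpha_l=1+l\Delta\alpha$, $\gamma_l=\alpha_l-1$ ($0\le l\le 2J$), $c_0=c_{2J}=\frac12$, $c_l=1$ for $1\le l\le 2J-1$. Time weights: for $\gamma\in[0,1]$, $g_0^{(\gamma)}=1$, $g_k^{(\gamma)}=\left(1-\frac{\gamma+1}{k}\right)g_{k-1}^{(\gamma)}$ ($k\ge1$); $\lambda_0^{(\gamma)}=(1+\frac\gamma2)g_0^{(\gamma)}$, $\lambda_k^{(\gamma)}=(1+\frac\gamma2)g_k^{(\gamma)}-\frac\gamma2g_{k-1}^{(\gamma)}$ ($k\ge1$). Space weights: $\hat g_k^{(\beta)}=\dfrac{(-1)^k\Gamma(\beta+1)}{\Gamma(\beta/2-k+1)\,\Gamma(\beta/2+k+1)}$, $k\in\mathbb Z$, with $1/\Gamma(z)=0$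 at non-positive integers $z$. Constant: $c_*^{(\beta)}=\frac2\beta r_\beta$ with $r_\beta=e^{-2}\dfrac{(4-\beta)(2-\beta)\beta}{(6+\beta)(4+\beta)(2+\beta)}\cdot\dfrac{\Gamma(\beta+1)}{\Gamma^2(\frac\beta2+1)}\left(3+\frac\beta2\right)^{\beta+1}$. Discrete fractional Sobolev (semi)norm: for a grid function $v$ with $v_0=v_M=0$ (extended by zero to $h\mathbb Z$), $|v|_{H^{\beta/2}}^2=\int_{-\pi/h}^{\pi/h}|k|^{\beta}|\hat v(k)|^2\,dk$, where $\hat v(k)=\frac{h}{\sqrt{2\pi}}\sum_{j=1}^{M-1}v_je^{-\mathbf i kx_j}$.
   Formalization: At β=2 the constant c_*^{(β)} is 0, so the stated bound divides by zero; the inequality is read in extended reals with a/0=∞ for a>0 and ∞·0=0, so at β=2 it is trivial unless u^0 and the G^n with n≤m all vanish. For β<2 it is the stated real inequality. *)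

theory Defs
  imports "HOL-Analysis.Analysis"
begin

text \<open>
  A time-dependent grid function is curried with the time level first: \<open>u n i\<close> stands for
  $u_i^n$, so \<open>u n\<close> is the spatial grid function at time level \<open>n\<close>.
\<close>

definition time_avg :: "(nat \<Rightarrow> nat \<Rightarrow> real) \<Rightarrow> nat \<Rightarrow> nat \<Rightarrow> real" where
  \<comment> \<open>$u_i^{n-1/2}$, for $n \ge 1$\<close>
  "time_avg u n i = (u n i + u (n - 1) i) / 2"

definition time_diff :: "real \<Rightarrow> (nat \<Rightarrow> nat \<Rightarrow> real) \<Rightarrow> nat \<Rightarrow> nat \<Rightarrow> real" where
  \<comment> \<open>$\delta_t u_i^{n-1/2}$, for $n \ge 1$; hence $\delta_t G_i^{n+1/2}$ is \<open>time_diff \<tau> G (n + 1) i\<close>\<close>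
  "time_diff \<tau> u n i = (u n i - u (n - 1) i) / \<tau>"

definition grid_norm_sq :: "real \<Rightarrow> nat \<Rightarrow> (nat \<Rightarrow> real) \<Rightarrow> real" where
  "grid_norm_sq h M v = h * (\<Sum>i=1..M-1. (v i)\<^sup>2)"

definition weight_function :: "(real \<Rightarrow> real) \<Rightarrow> bool" where
  \<comment> \<open>The requirement $\omega \ne 0$ is read as: $\omega$ does not vanish identically on $[1,2]$.
    This is the weaker reading of the hypothesis.\<close>
  "weight_function \<omega> \<longleftrightarrow>
     (\<forall>\<alpha>\<in>{1..2}. \<omega> \<alpha> \<ge> 0) \<and> (\<exists>\<alpha>\<in>{1..2}. \<omega> \<alpha> \<noteq> 0) \<and>
     \<omega> integrable_on {1..2} \<and> 0 < integral {1..2} \<omega>"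

definition order_step :: "nat \<Rightarrow> real" where
  "order_step J = 1 / (2 * real J)"

definition order_node :: "nat \<Rightarrow> nat \<Rightarrow> real" where
  "order_node J l = 1 + real l * order_step J"

definition gamma_node :: "nat \<Rightarrow> nat \<Rightarrow> real" where
  "gamma_node J l = order_node J l - 1"

definition trapezoid_coeff :: "nat \<Rightarrow> nat \<Rightarrow> real" where
  "trapezoid_coeff J l = (if l = 0 \<or> l = 2 * J then 1 / 2 else 1)"

primrec g_weight :: "real \<Rightarrow> nat \<Rightarrow> real" where
  "g_weight \<gamma> 0 = 1"
| "g_weight \<gamma> (Suc k) = (1 - (\<gamma> + 1) / real (Suc k)) * g_weight \<gamma> k"

definition lambda_weight :: "real \<Rightarrow> nat \<Rightarrow> real" where
  "lambda_weight \<gamma> k =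
     (if k = 0 then (1 + \<gamma> / 2) * g_weight \<gamma> 0
      else (1 + \<gamma> / 2) * g_weight \<gamma> k - \<gamma> / 2 * g_weight \<gamma> (k - 1))"

definition space_weight :: "real \<Rightarrow> int \<Rightarrow> real" where
  \<comment> \<open>\<^const>\<open>rGamma\<close> is the reciprocal Gamma function, which is zero at the non-positive integers.\<close>
  "space_weight \<beta> k =
     (- 1) powi k * Gamma (\<beta> + 1)
       * rGamma (\<beta> / 2 - of_int k + 1) * rGamma (\<beta> / 2 + of_int k + 1)"

definition r_const :: "real \<Rightarrow> real" where
  "r_const \<beta> =
     exp (- 2) * (((4 - \<beta>) * (2 - \<beta>) * \<beta>) / ((6 + \<beta>) * (4 + \<beta>) * (2 + \<beta>)))
       * (Gamma (\<beta> + 1) / (Gamma (\<beta> / 2 + 1))\<^sup>2) * (3 + \<beta> / 2) powr (\<beta> + 1)"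

definition c_star :: "real \<Rightarrow> real" where
  \<comment> \<open>Positive for $0 < \beta < 2$, but zero for $\beta = 2$. Estimates with \<open>c_star \<beta>\<close> in a
    denominator are therefore stated in \<^typ>\<open>ereal\<close>, where $a / 0 = \infty$ for $a > 0$ (and
    $\infty \cdot 0 = 0$), rather than in \<^typ>\<open>real\<close>, where $a / 0 = 0$.\<close>
  "c_star \<beta> = 2 / \<beta> * r_const \<beta>"

definition grid_fourier :: "real \<Rightarrow> nat \<Rightarrow> (nat \<Rightarrow> real) \<Rightarrow> real \<Rightarrow> complex" where
  "grid_fourier h M v k =
     complex_of_real (h / sqrt (2 * pi)) *
       (\<Sum>j=1..M-1. complex_of_real (v j) * exp (- (\<i> * complex_of_real (k * (real j * h)))))"

definition frac_seminorm_sq :: "real \<Rightarrow> real \<Rightarrow> nat \<Rightarrow> (nat \<Rightarrow> real) \<Rightarrow> real" where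
  \<comment> \<open>$|v|_{H^{\beta/2}}^2$ for a grid function on the mesh of width \<open>h\<close>\<close>
  "frac_seminorm_sq \<beta> h M v =
     integral {- pi / h..pi / h} (\<lambda>k. \<bar>k\<bar> powr \<beta> * (cmod (grid_fourier h M v k))\<^sup>2)"

end

theory Submission
  imports Defs
begin

text \<open>
  The estimate is an energy estimate. Multiply the scheme at level \<open>n\<close> by the difference quotient
  \<open>(u\<^sub>i\<^sup>n - u\<^sub>i\<^sup>n\<^sup>-\<^sup>1) / \<tau>\<close> and sum over the interior nodes and over the levels \<open>1..m\<close>.

  The memory term becomes a nonnegative combination of the convolution forms
  \<open>\<Sum>n. \<Sum>k. \<lambda>\<^sub>k v\<^sub>n\<^sub>-\<^sub>k v\<^sub>n\<close>. Each of them is nonnegative, because the generating function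
  \<open>(1 - z)\<^sup>\<gamma> (1 + \<gamma>/2 (1 - z))\<close> of the weights \<open>\<lambda>\<^sub>k\<close> has nonnegative real part on the unit disc
  (\<open>lambda_weight_form_nonneg\<close>). The space term is a symmetric Toeplitz form \<open>S\<close> paired with a time
  average and a time difference, so it telescopes to half of \<open>S(u\<^sup>m, u\<^sup>m) - S(u\<^sup>0, u\<^sup>0)\<close>. In the source
  term, summation by parts moves the time difference from \<open>u\<close> to \<open>G\<close>.

  The energy \<open>h\<^sup>1\<^sup>-\<^sup>\<beta> S(v, v)\<close> is compared with the two norms of the statement as follows.
  From below (\<open>space_form_coercive\<close>): the space weights are positive at \<open>0\<close> and nonpositive
  elsewhere, hence the form is diagonally dominant, and its row sums telescope to explicit products
  that are at least \<open>c\<^sub>* M\<^sup>-\<^sup>\<beta>\<close>; as \<open>h M = L\<close>, the energy is at least \<open>c\<^sub>* L\<^sup>-\<^sup>\<beta>\<close> times the squared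
  grid norm. From above (\<open>space_form_le_seminorm\<close>): the weights are the Fourier coefficients of
  \<open>\<bar>2 sin (x/2)\<bar>\<^sup>\<beta>\<close>, which is at most \<open>\<bar>x\<bar>\<^sup>\<beta>\<close>.
  Young's inequality and the discrete Gronwall inequality then give the bound when \<open>\<beta> < 2\<close>.

  For \<open>\<beta> = 2\<close> the constant \<open>c\<^sub>*\<close> vanishes, and the right-hand side is infinite unless the initial
  seminorm and all source terms up to level \<open>m\<close> are zero. In that case the energy inequality forces
  \<open>S(u\<^sup>m, u\<^sup>m) \<le> 0\<close>, and the form is still definite (\<open>space_form_definite\<close>), so \<open>u\<^sup>m = 0\<close>.
\<close>

section \<open>Energies of trigonometric sums\<close>

text \<open>
  The squared modulus of the trigonometric polynomial with coefficients \<open>v\<close>. It is kept in real form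
  because both applications integrate it against real even weights.
\<close>

definition trig_energy :: "nat set \<Rightarrow> (nat \<Rightarrow> real) \<Rightarrow> real \<Rightarrow> real" where
  "trig_energy S v x = (\<Sum>j\<in>S. v j * cos (real j * x))\<^sup>2 + (\<Sum>j\<in>S. v j * sin (real j * x))\<^sup>2"

lemma trig_energy_nonneg: "0 \<le> trig_energy S v x"
  unfolding trig_energy_def by simp

lemma trig_energy_eq_cos_diff:
  "trig_energy S v x = (\<Sum>i\<in>S. \<Sum>j\<in>S. v i * v j * cos (of_int (int i - int j) * x))"
proof -
  have "trig_energy S v x = (\<Sum>i\<in>S. \<Sum>j\<in>S. v i * cos (real i * x) * (v j * cos (real j * x))
      + v i * sin (real i * x) * (v j * sin (real j * x)))"
    unfolding trig_energy_def power2_eq_square sum_product sum.distrib ..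
  also have "\<dots> = (\<Sum>i\<in>S. \<Sum>j\<in>S. v i * v j * cos (of_int (int i - int j) * x))"
    by (intro sum.cong refl) (simp add: cos_diff left_diff_distrib algebra_simps)
  finally show ?thesis .
qed

text \<open>
  The bridge between weights and Toeplitz forms: if \<open>c\<close> lists the cosine moments of \<open>w\<close>, then the
  Toeplitz form with kernel \<open>c\<close> is the integral of \<open>w\<close> against a trigonometric energy. Pointwise
  bounds on \<open>w\<close> thus become bounds on quadratic forms.
\<close>

lemma has_integral_weight_trig_energy:
  assumes "finite S"
    and "\<And>k::int. ((\<lambda>x. w x * cos (of_int k * x)) has_integral c k) I"
  shows "((\<lambda>x. w x * trig_energy S v x) has_integral
           (\<Sum>i\<in>S. \<Sum>j\<in>S. v i * v j * c (int i - int j))) I"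
proof -
  have "((\<lambda>x. \<Sum>i\<in>S. \<Sum>j\<in>S. v i * v j * (w x * cos (of_int (int i - int j) * x)))
          has_integral (\<Sum>i\<in>S. \<Sum>j\<in>S. v i * v j * c (int i - int j))) I"
    using assms by (intro has_integral_sum has_integral_mult_right)
  then show ?thesis
    unfolding trig_energy_eq_cos_diff sum_distrib_left by (simp add: mult_ac)
qed

section \<open>Positivity of the time weights\<close>

text \<open>
  At most one of \<open>e j\<close> and \<open>e (- j)\<close> is nonzero when \<open>j \<noteq> 0\<close>. At \<open>j = 0\<close> both count, in accordance
  with the constant function having twice the mean square of any other cosine.
\<close>

lemma has_integral_cos_sum_cos:
  fixes \<mu> :: "nat \<Rightarrow> real" and j :: int and Q :: nat
  defines "e \<equiv> \<lambda>k::int. if 0 \<le> k \<and> k < int Q then \<mu> (nat k) else 0"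
  shows "((\<lambda>x. (\<Sum>k<Q. \<mu> k * cos (real k * x)) * cos (of_int j * x)) has_integral
            pi * (e j + e (- j))) {-pi..pi}"
proof -
  define d where "d = (\<lambda>k::int. if k = 0 then 2 * pi else 0)"
  have "((\<lambda>x. \<Sum>k<Q. \<mu> k / 2 * (cos (of_int (int k - j) * x) + cos (of_int (int k + j) * x)))
          has_integral (\<Sum>k<Q. \<mu> k / 2 * (d (int k - j) + d (int k + j)))) {-pi..pi}"
    unfolding d_def
    by (intro has_integral_sum has_integral_mult_right has_integral_add has_integral_cos_nx) auto
  moreover have "(\<Sum>k<Q. \<mu> k / 2 * (cos (of_int (int k - j) * x) + cos (of_int (int k + j) * x)))
      = (\<Sum>k<Q. \<mu> k * cos (real k * x)) * cos (of_int j * x)" for x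
    unfolding sum_distrib_right
    by (intro sum.cong refl) (simp add: cos_diff cos_add algebra_simps)
  moreover have "(\<Sum>k<Q. \<mu> k / 2 * (d (int k - j) + d (int k + j))) = pi * (e j + e (- j))"
  proof -
    \<comment> \<open>Orthogonality of the cosines selects the coefficient with index \<open>i\<close>.\<close>
    have sel: "(\<Sum>k<Q. \<mu> k / 2 * d (int k - i)) = pi * e i" for i
    proof (cases "0 \<le> i \<and> i < int Q")
      case True
      have "(\<Sum>k<Q. \<mu> k / 2 * d (int k - i)) = (\<Sum>k<Q. if k = nat i then pi * \<mu> k else 0)"
        using True by (intro sum.cong refl) (auto simp: d_def)
      also have "\<dots> = pi * \<mu> (nat i)"
        using True by (subst sum.delta) auto
      finally show ?thesis using True by (simp add: e_def)
    next
      case False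
      then have "\<mu> k / 2 * d (int k - i) = 0" if "k < Q" for k
        using that by (auto simp: d_def)
      then have "(\<Sum>k<Q. \<mu> k / 2 * d (int k - i)) = 0"
        by (intro sum.neutral) blast
      moreover have "e i = 0" using False by (auto simp: e_def)
      ultimately show ?thesis by simp
    qed
    have "(\<Sum>k<Q. \<mu> k / 2 * (d (int k - j) + d (int k - (- j)))) = pi * e j + pi * e (- j)"
      unfolding distrib_left sum.distrib sel ..
    then show ?thesis by (simp add: distrib_left)
  qed
  ultimately show ?thesis by simp
qed

text \<open>
  A one-sided convolution form with coefficients \<open>e\<close> is half of the symmetric Toeplitz form with kernel
  \<open>e j + e (- j)\<close>, so it is an energy integral with the cosine polynomial of \<open>\<mu>\<close> as weight. Coefficients beyond index
  \<open>m - 1\<close> are invisible to a form with \<open>m\<close> levels, which leaves the truncation \<open>Q\<close> free.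
\<close>

lemma convolution_form_eq_cos_integral:
  assumes "m \<le> Q"
  shows "((\<lambda>x. (\<Sum>k<Q. \<mu> k * cos (real k * x)) * trig_energy {1..m} v x) has_integral
           2 * pi * (\<Sum>n=1..m. \<Sum>k=0..n-1. \<mu> k * v (n - k) * v n)) {-pi..pi}"
proof -
  define e where "e = (\<lambda>k::int. if 0 \<le> k \<and> k < int Q then \<mu> (nat k) else 0)"
  let ?S = "{1..m}"
  have "((\<lambda>x. (\<Sum>k<Q. \<mu> k * cos (real k * x)) * trig_energy ?S v x) has_integral
     (\<Sum>i\<in>?S. \<Sum>j\<in>?S. v i * v j * (pi * (e (int i - int j) + e (- (int i - int j)))))) {-pi..pi}"
    unfolding e_def by (rule has_integral_weight_trig_energy[OF _ has_integral_cos_sum_cos]) simp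
  also have "(\<Sum>i\<in>?S. \<Sum>j\<in>?S. v i * v j * (pi * (e (int i - int j) + e (- (int i - int j)))))
     = pi * (\<Sum>i\<in>?S. \<Sum>j\<in>?S. v i * v j * e (int i - int j))
      + pi * (\<Sum>i\<in>?S. \<Sum>j\<in>?S. v i * v j * e (int j - int i))"
    by (simp add: sum.distrib sum_distrib_left algebra_simps)
  also have "(\<Sum>i\<in>?S. \<Sum>j\<in>?S. v i * v j * e (int j - int i))
     = (\<Sum>i\<in>?S. \<Sum>j\<in>?S. v i * v j * e (int i - int j))"
    by (subst sum.swap) (simp add: mult_ac)
  also have "(\<Sum>i\<in>?S. \<Sum>j\<in>?S. v i * v j * e (int i - int j))
     = (\<Sum>n\<in>?S. \<Sum>k=0..n-1. \<mu> k * v (n - k) * v n)"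
  proof (rule sum.cong[OF refl])
    fix n assume n: "n \<in> ?S"
    have "(\<Sum>j\<in>?S. v n * v j * e (int n - int j)) = (\<Sum>j\<in>{1..n}. v n * v j * e (int n - int j))"
      using n by (intro sum.mono_neutral_right) (auto simp: e_def)
    also have "\<dots> = (\<Sum>k=0..n-1. \<mu> k * v (n - k) * v n)"
      by (rule sum.reindex_bij_witness[where i = "\<lambda>k. n - k" and j = "\<lambda>j. n - j"])
         (use n assms in \<open>auto simp: e_def nat_diff_distrib of_nat_diff\<close>)
    finally show "(\<Sum>j\<in>?S. v n * v j * e (int n - int j)) = (\<Sum>k=0..n-1. \<mu> k * v (n - k) * v n)" .
  qed
  finally show ?thesis by (simp add: algebra_simps)
qed

text \<open>
  Nonnegativity of the full cosine series is inherited by the form, although truncated series may be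
  negative: uniformly in \<open>x\<close>, a truncation at a large \<open>Q\<close> is at least \<open>- \<epsilon>\<close>, the form does not depend on \<open>Q\<close>, and
  \<open>\<epsilon>\<close> is arbitrary.
\<close>

lemma convolution_form_nonneg:
  fixes \<mu> :: "nat \<Rightarrow> real"
  assumes summ: "summable (\<lambda>k. \<bar>\<mu> k\<bar>)"
    and pos: "\<And>x. 0 \<le> (\<Sum>k. \<mu> k * cos (real k * x))"
  shows "0 \<le> (\<Sum>n=1..m. \<Sum>k=0..n-1. \<mu> k * v (n - k) * v n)"
proof -
  define F where "F = (\<Sum>n=1..m. \<Sum>k=0..n-1. \<mu> k * v (n - k) * v n)"
  define E where "E = (\<Sum>n=1..m. \<Sum>k=0..n-1. (if k = 0 then 1 else 0) * v (n - k) * v n)"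
  \<comment> \<open>The coefficients \<open>1, 0, 0, \<dots>\<close> give the constant weight \<open>1\<close>, so \<open>E\<close> is the mean of the energy.\<close>
  have intE: "(trig_energy {1..m} v has_integral 2 * pi * E) {-pi..pi}"
  proof -
    have "(\<Sum>k<Suc m. (if k = 0 then 1 else 0) * cos (real k * x)) = 1" for x :: real
      by (subst sum.cong[OF refl, of _ _ "\<lambda>k. if k = 0 then 1 else 0"]) auto
    then show ?thesis
      using convolution_form_eq_cos_integral[of m "Suc m" "\<lambda>k. if k = 0 then 1 else 0" v]
      unfolding E_def by simp
  qed
  have low: "- \<epsilon> * E \<le> F" if eps: "\<epsilon> > 0" for \<epsilon>
  proof -
    obtain N0 where N0: "\<And>n. n \<ge> N0 \<Longrightarrow> norm (\<Sum>i. \<bar>\<mu> (i + n)\<bar>) < \<epsilon>"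
      using suminf_exist_split[OF eps summ] by auto
    define Q where "Q = max m N0"
    have "- \<epsilon> \<le> (\<Sum>k<Q. \<mu> k * cos (real k * x))" for x
    proof -
      have b: "\<bar>\<mu> k * cos (real k * x)\<bar> \<le> \<bar>\<mu> k\<bar>" for k
        by (simp add: abs_mult mult_left_le)
      have sa: "summable (\<lambda>k. \<mu> k * cos (real k * x))"
        by (rule summable_comparison_test'[OF summ]) (use b in auto)
      have sm: "summable (\<lambda>k. \<bar>\<mu> (k + Q)\<bar>)"
        using summ by (subst summable_iff_shift)
      have st: "summable (\<lambda>k. \<mu> (k + Q) * cos (real (k + Q) * x))"
        using sa by (subst summable_iff_shift)
      have "(\<Sum>k. \<mu> (k + Q) * cos (real (k + Q) * x)) \<le> (\<Sum>k. \<bar>\<mu> (k + Q)\<bar>)"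
        by (rule suminf_le[OF _ st sm]) (rule order_trans[OF abs_ge_self b])
      also have "\<dots> < \<epsilon>" using N0[of Q] by (simp add: Q_def)
      finally show ?thesis
        using suminf_split_initial_segment[OF sa, of Q] pos[of x] by linarith
    qed
    then have "- \<epsilon> * trig_energy {1..m} v x
        \<le> (\<Sum>k<Q. \<mu> k * cos (real k * x)) * trig_energy {1..m} v x" for x
      by (rule mult_right_mono[OF _ trig_energy_nonneg])
    then have "- \<epsilon> * (2 * pi * E) \<le> 2 * pi * F"
      unfolding F_def
      by (intro has_integral_le[OF has_integral_mult_right[OF intE]
            convolution_form_eq_cos_integral[of m Q \<mu> v]])
         (auto simp: Q_def)
    then have "2 * pi * (- \<epsilon> * E) \<le> 2 * pi * F" by (simp add: mult_ac)
    then show ?thesis by (rule mult_left_le_imp_le) simp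
  qed
  show "0 \<le> F"
  proof (rule tendsto_upperbound)
    show "((\<lambda>\<epsilon>. - \<epsilon> * E) \<longlongrightarrow> 0) (at_right 0)"
      by (rule tendsto_eq_intros refl tendsto_mult_left_zero | simp)+
    show "\<forall>\<^sub>F \<epsilon> in at_right 0. - \<epsilon> * E \<le> F"
      using low by (auto simp: eventually_at_right_less intro: eventually_at_right_less[THEN eventually_mono])
  qed simp
qed

lemma abs_g_weight_le_1: "0 \<le> \<gamma> \<Longrightarrow> \<gamma> \<le> 1 \<Longrightarrow> \<bar>g_weight \<gamma> k\<bar> \<le> 1"
proof (induction k)
  case (Suc k)
  have "\<bar>1 - (\<gamma> + 1) / real (Suc k)\<bar> \<le> 1"
    using Suc.prems by (auto simp: abs_le_iff field_simps)
  then show ?case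
    using Suc by (simp add: abs_mult mult_le_one del: of_nat_Suc)
qed simp

lemma g_weight_eq_gbinomial: "complex_of_real (g_weight \<gamma> k) = (- 1) ^ k * (of_real \<gamma> gchoose k)"
proof (induction k)
  case (Suc k)
  have "of_nat (Suc k) * (of_real \<gamma> gchoose Suc k) = (of_real \<gamma> - of_nat k) * (of_real \<gamma> gchoose k :: complex)"
    using gbinomial_mult_1[of "of_real \<gamma> :: complex" k] by (simp add: algebra_simps)
  then have "(of_real \<gamma> gchoose Suc k) = (of_real \<gamma> - of_nat k) * (of_real \<gamma> gchoose k) / (of_nat (Suc k) :: complex)"
    by (metis nonzero_mult_div_cancel_left of_nat_neq_0)
  moreover have "complex_of_real (g_weight \<gamma> (Suc k))
      = (of_nat k - of_real \<gamma>) / of_nat (Suc k) * of_real (g_weight \<gamma> k)"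
    using of_nat_neq_0[of k, where 'a = complex] by (simp add: field_simps)
  ultimately show ?case by (simp only: Suc.IH) (simp add: field_simps)
qed simp

lemma g_weight_generating_function:
  assumes "cmod z < 1"
  shows "(\<lambda>k. of_real (g_weight \<gamma> k) * z ^ k) sums ((1 - z) powr of_real \<gamma>)"
  using gen_binomial_complex[of "- z" "of_real \<gamma>"] assms
  by (simp add: g_weight_eq_gbinomial power_minus[of z] mult_ac)

text \<open>
  The numbers \<open>g\<^sub>k\<close> are the binomial coefficients of \<open>(1 - z)\<^sup>\<gamma>\<close>, and the definition of \<open>\<lambda>\<^sub>k\<close> multiplies
  that series by \<open>1 + \<gamma>/2 - \<gamma>/2 z\<close>.
\<close>

lemma lambda_weight_generating_function:
  assumes "cmod z < 1"
  shows "(\<lambda>k. of_real (lambda_weight \<gamma> k) * z ^ k)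
    sums ((1 - z) powr of_real \<gamma> * (1 + of_real (\<gamma> / 2) * (1 - z)))"
proof -
  let ?g = "\<lambda>k. of_real (g_weight \<gamma> k) * z ^ k" and ?s = "(1 - z) powr of_real \<gamma>"
  have g: "?g sums ?s" by (rule g_weight_generating_function[OF assms])
  have 1: "(\<lambda>k. of_real (1 + \<gamma> / 2) * ?g k) sums (of_real (1 + \<gamma> / 2) * ?s)"
    by (rule sums_mult[OF g])
  have "(\<lambda>k. of_real (\<gamma> / 2) * z * ?g k) sums (of_real (\<gamma> / 2) * z * ?s)"
    by (rule sums_mult[OF g])
  then have "(\<lambda>k. case k of 0 \<Rightarrow> 0 | Suc j \<Rightarrow> of_real (\<gamma> / 2) * z * ?g j)
      sums (of_real (\<gamma> / 2) * z * ?s)"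
    by (subst sums_Suc_iff[symmetric, where ?f = "\<lambda>k. case k of 0 \<Rightarrow> 0 | Suc j \<Rightarrow> _ j", simplified]) simp
  from sums_diff[OF 1 this] have "(\<lambda>k. of_real (1 + \<gamma> / 2) * ?g k -
      (case k of 0 \<Rightarrow> 0 | Suc j \<Rightarrow> of_real (\<gamma> / 2) * z * ?g j))
      sums (?s * (1 + of_real (\<gamma> / 2) * (1 - z)))"
    by (simp add: algebra_simps add_divide_distrib diff_divide_distrib)
  then show ?thesis
    by (rule sums_cong[THEN iffD1, rotated])
       (auto simp: lambda_weight_def algebra_simps split: nat.split)
qed

text \<open>
  This is \<open>tan (\<gamma> a) \<le> \<gamma> tan a\<close> without denominators. The difference of the two sides vanishes at \<open>0\<close>
  and has derivative \<open>(1 - \<gamma>\<^sup>2) sin t sin (\<gamma> t) \<ge> 0\<close>.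
\<close>

lemma cos_mult_sin_mult_le:
  assumes "0 \<le> \<gamma>" "\<gamma> \<le> 1" "0 \<le> a" "a \<le> pi / 2"
  shows "cos a * sin (\<gamma> * a) \<le> \<gamma> * sin a * cos (\<gamma> * a)"
proof -
  let ?D = "\<lambda>t. \<gamma> * sin t * cos (\<gamma> * t) - cos t * sin (\<gamma> * t)"
  have "?D 0 \<le> ?D a"
  proof (rule DERIV_nonneg_imp_nondecreasing[OF assms(3)])
    fix t assume t: "0 \<le> t" "t \<le> a"
    have "(?D has_real_derivative (1 - \<gamma>\<^sup>2) * (sin t * sin (\<gamma> * t))) (at t)"
      by (rule derivative_eq_intros refl)+ (simp add: algebra_simps power2_eq_square)
    moreover have "0 \<le> sin t" using t assms by (intro sin_ge_zero) auto
    moreover have "\<gamma> * t \<le> pi"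
      using t assms mult_left_le_one_le[of t \<gamma>] pi_gt_zero by linarith
    then have "0 \<le> sin (\<gamma> * t)" using t assms by (intro sin_ge_zero) auto
    moreover have "\<gamma>\<^sup>2 \<le> 1" using assms by (simp add: power_le_one)
    ultimately show "\<exists>y. (?D has_real_derivative y) (at t) \<and> 0 \<le> y"
      by (metis diff_ge_0_iff_ge mult_nonneg_nonneg)
  qed
  then show ?thesis by simp
qed

text \<open>
  After expanding \<open>cos ((1 + \<gamma>) a)\<close>, the only negative contribution is
  \<open>\<gamma> sin a cos a sin (\<gamma> a)\<close>, which the previous lemma bounds by
  \<open>(\<gamma> sin a)\<^sup>2 cos (\<gamma> a) \<le> cos (\<gamma> a)\<close>.
\<close>

lemma sector_bound:
  assumes "0 \<le> \<gamma>" "\<gamma> \<le> 1" "\<bar>a\<bar> \<le> pi / 2"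
  shows "0 \<le> cos (\<gamma> * a)" "0 \<le> cos (\<gamma> * a) + \<gamma> * cos a * cos ((1 + \<gamma>) * a)"
proof -
  have *: "0 \<le> cos (\<gamma> * a) \<and> 0 \<le> cos (\<gamma> * a) + \<gamma> * cos a * cos ((1 + \<gamma>) * a)"
    if a: "0 \<le> a" "a \<le> pi / 2" for a
  proof -
    have "\<gamma> * a \<le> pi / 2"
      using a assms mult_left_le_one_le[of a \<gamma>] by linarith
    then have c: "0 \<le> cos (\<gamma> * a)"
      using a assms pi_gt_zero by (intro cos_ge_zero) (auto intro: order_trans[of _ 0])
    have s: "0 \<le> sin a" using a by (intro sin_ge_zero) auto
    have "\<gamma> * sin a * (cos a * sin (\<gamma> * a)) \<le> \<gamma> * sin a * (\<gamma> * sin a * cos (\<gamma> * a))"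
      using cos_mult_sin_mult_le[OF assms(1,2) a] s assms by (intro mult_left_mono) auto
    also have "\<dots> = (\<gamma> * sin a)\<^sup>2 * cos (\<gamma> * a)" by (simp add: power2_eq_square)
    also have "\<dots> \<le> 1 * cos (\<gamma> * a)"
      using c s assms by (intro mult_right_mono power_le_one mult_le_one) auto
    finally have 1: "\<gamma> * sin a * (cos a * sin (\<gamma> * a)) \<le> cos (\<gamma> * a)" by simp
    have "cos ((1 + \<gamma>) * a) = cos a * cos (\<gamma> * a) - sin a * sin (\<gamma> * a)"
      by (simp add: distrib_right cos_add)
    then have "cos (\<gamma> * a) + \<gamma> * cos a * cos ((1 + \<gamma>) * a)
      = cos (\<gamma> * a) - \<gamma> * sin a * (cos a * sin (\<gamma> * a)) + \<gamma> * (cos a)\<^sup>2 * cos (\<gamma> * a)"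
      by (simp only:) (simp add: algebra_simps power2_eq_square)
    moreover have "0 \<le> \<gamma> * (cos a)\<^sup>2 * cos (\<gamma> * a)" using c assms by simp
    ultimately show ?thesis using 1 c by linarith
  qed
  show "0 \<le> cos (\<gamma> * a)" "0 \<le> cos (\<gamma> * a) + \<gamma> * cos a * cos ((1 + \<gamma>) * a)"
    using *[of "\<bar>a\<bar>"] assms(3) by (auto simp: abs_if split: if_splits)
qed

text \<open>
  With \<open>1 - z = \<rho> e\<^sup>i\<^sup>a\<close>, the real part is \<open>\<rho>\<^sup>\<gamma> (cos (\<gamma> a) + \<gamma>/2 \<rho> cos ((1 + \<gamma>) a))\<close>. The disc
  \<open>\<bar>z\<bar> < 1\<close> is \<open>\<rho> < 2 cos a\<close>, so a negative second summand is worst at \<open>\<rho> = 2 cos a\<close>, which is the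
  case settled by \<open>sector_bound\<close>.
\<close>

lemma Re_symbol_nonneg:
  assumes "0 \<le> \<gamma>" "\<gamma> \<le> 1" "cmod z < 1"
  shows "0 \<le> Re ((1 - z) powr of_real \<gamma> * (1 + of_real (\<gamma> / 2) * (1 - z)))"
proof -
  define w where "w = 1 - z"
  define \<rho> a where "\<rho> = cmod w" and "a = Arg w"
  have "w \<noteq> 0" using assms(3) by (auto simp: w_def)
  have w: "w = of_real \<rho> * exp (\<i> * of_real a)"
    unfolding \<rho>_def a_def using Arg_eq[OF \<open>w \<noteq> 0\<close>] .
  have rho: "\<rho> > 0" using \<open>w \<noteq> 0\<close> by (simp add: \<rho>_def)
  have Rew: "Re w > 0"
    using complex_Re_le_cmod[of z] assms(3) by (simp add: w_def)
  then have a: "\<bar>a\<bar> < pi / 2" unfolding a_def Arg_Re_pos by simp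
  have Rew2: "Re w = \<rho> * cos a" by (subst w) (simp add: Re_exp)
  have "(cmod (1 - w))\<^sup>2 < 1" using assms(3) by (simp add: w_def power_less_one_iff abs_square_less_1)
  moreover have "(cmod (1 - w))\<^sup>2 = 1 - 2 * Re w + \<rho>\<^sup>2"
    unfolding \<rho>_def cmod_power2 by (simp add: power2_eq_square algebra_simps)
  ultimately have "\<rho> * \<rho> < \<rho> * (2 * cos a)" using Rew2 by (simp add: power2_eq_square)
  then have r2: "\<rho> < 2 * cos a" using rho by simp
  have pw: "w powr of_real \<gamma> = of_real (\<rho> powr \<gamma>) * exp (\<i> * of_real (\<gamma> * a))"
  proof -
    have "w powr of_real \<gamma> = exp (of_real \<gamma> * Ln w)" using \<open>w \<noteq> 0\<close> by (simp add: powr_def)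
    also have "Ln w = of_real (ln \<rho>) + \<i> * of_real a"
      using \<open>w \<noteq> 0\<close> Re_Ln[OF \<open>w \<noteq> 0\<close>]
      by (intro complex_eqI) (simp_all add: \<rho>_def a_def Arg_def del: Re_Ln)
    also have "exp (of_real \<gamma> * (of_real (ln \<rho>) + \<i> * of_real a))
       = of_real (\<rho> powr \<gamma>) * exp (\<i> * of_real (\<gamma> * a))"
      using rho by (simp add: powr_def exp_add[symmetric] exp_of_real[symmetric] algebra_simps)
    finally show ?thesis .
  qed
  have "w powr of_real \<gamma> * (1 + of_real (\<gamma> / 2) * w)
     = of_real (\<rho> powr \<gamma>) * (exp (\<i> * of_real (\<gamma> * a))
        + of_real (\<gamma> / 2 * \<rho>) * exp (\<i> * of_real ((1 + \<gamma>) * a)))"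
    unfolding pw by (subst w) (simp add: algebra_simps exp_add)
  then have "Re (w powr of_real \<gamma> * (1 + of_real (\<gamma> / 2) * w))
     = \<rho> powr \<gamma> * (cos (\<gamma> * a) + \<gamma> / 2 * \<rho> * cos ((1 + \<gamma>) * a))"
    by (simp add: Re_exp)
  moreover have "0 \<le> cos (\<gamma> * a) + \<gamma> / 2 * \<rho> * cos ((1 + \<gamma>) * a)"
  proof (cases "0 \<le> cos ((1 + \<gamma>) * a)")
    case True
    then show ?thesis using sector_bound(1)[of \<gamma> a] a assms rho by simp
  next
    case False
    have "\<gamma> / 2 * \<rho> \<le> \<gamma> * cos a" using r2 assms mult_left_mono[of \<rho> "2 * cos a" "\<gamma> / 2"] by simp
    then have "\<gamma> * cos a * cos ((1 + \<gamma>) * a) \<le> \<gamma> / 2 * \<rho> * cos ((1 + \<gamma>) * a)"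
      using False by (intro mult_right_mono_neg) auto
    then show ?thesis using sector_bound(2)[of \<gamma> a] a assms by linarith
  qed
  ultimately show ?thesis by (simp add: w_def)
qed

lemma abs_lambda_weight_le_2:
  assumes "0 \<le> \<gamma>" "\<gamma> \<le> 1"
  shows "\<bar>lambda_weight \<gamma> k\<bar> \<le> 2"
proof -
  have *: "\<bar>(1 + \<gamma> / 2) * g_weight \<gamma> j\<bar> \<le> 1 + \<gamma> / 2" "\<bar>\<gamma> / 2 * g_weight \<gamma> j\<bar> \<le> \<gamma> / 2" for j
    using abs_g_weight_le_1[OF assms, of j] assms by (auto simp: abs_mult mult_left_le)
  show ?thesis
    using *(1)[of k] *(2)[of "k - 1"] assms(2)
      abs_triangle_ineq4[of "(1 + \<gamma> / 2) * g_weight \<gamma> k" "\<gamma> / 2 * g_weight \<gamma> (k - 1)"]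
    unfolding lambda_weight_def by (cases "k = 0") (simp_all del: g_weight.simps(2))
qed

text \<open>
  The coefficients are damped to \<open>\<lambda>\<^sub>k r\<^sup>k\<close> with \<open>r < 1\<close>, so that the power series converges absolutely;
  the form is a polynomial in \<open>r\<close>, and \<open>r\<close> tends to \<open>1\<close>.
\<close>

lemma lambda_weight_form_nonneg:
  assumes \<gamma>: "0 \<le> \<gamma>" "\<gamma> \<le> 1"
  shows "0 \<le> (\<Sum>n=1..m. \<Sum>k=0..n-1. lambda_weight \<gamma> k * v (n - k) * v n)"
proof -
  have damped: "0 \<le> (\<Sum>n=1..m. \<Sum>k=0..n-1. lambda_weight \<gamma> k * r ^ k * v (n - k) * v n)"
    if r: "0 < r" "r < 1" for r :: real
  proof (rule convolution_form_nonneg)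
    show "summable (\<lambda>k. \<bar>lambda_weight \<gamma> k * r ^ k\<bar>)"
    proof (rule summable_comparison_test')
      show "summable (\<lambda>k. 2 * r ^ k)" using r by (intro summable_mult summable_geometric) auto
      show "norm \<bar>lambda_weight \<gamma> k * r ^ k\<bar> \<le> 2 * r ^ k" if "k \<ge> 0" for k
        using abs_lambda_weight_le_2[OF \<gamma>, of k] r by (simp add: abs_mult mult_right_mono)
    qed
    fix x :: real
    let ?z = "of_real r * exp (\<i> * of_real x)"
    have z: "cmod ?z < 1" using r by (simp add: norm_mult)
    have "(\<lambda>k. Re (of_real (lambda_weight \<gamma> k) * ?z ^ k))
        sums Re ((1 - ?z) powr of_real \<gamma> * (1 + of_real (\<gamma> / 2) * (1 - ?z)))"
      using lambda_weight_generating_function[OF z] sums_Re by blast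
    moreover have "Re (of_real (lambda_weight \<gamma> k) * ?z ^ k)
        = lambda_weight \<gamma> k * r ^ k * cos (real k * x)" for k
    proof -
      have "?z ^ k = of_real (r ^ k) * exp (of_nat k * (\<i> * of_real x))"
        by (simp add: power_mult_distrib exp_of_nat_mult)
      then show ?thesis by (simp add: Re_exp del: of_real_power)
    qed
    ultimately show "0 \<le> (\<Sum>k. lambda_weight \<gamma> k * r ^ k * cos (real k * x))"
      using Re_symbol_nonneg[OF \<gamma> z] by (simp only: sums_iff)
  qed
  show ?thesis
  proof (rule tendsto_lowerbound)
    have "((\<lambda>r::real. \<Sum>n=1..m. \<Sum>k=0..n-1. lambda_weight \<gamma> k * r ^ k * v (n - k) * v n) \<longlongrightarrow>
       (\<Sum>n=1..m. \<Sum>k=0..n-1. lambda_weight \<gamma> k * 1 ^ k * v (n - k) * v n)) (at_left 1)"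
      by (intro tendsto_intros)
    then show "((\<lambda>r::real. \<Sum>n=1..m. \<Sum>k=0..n-1. lambda_weight \<gamma> k * r ^ k * v (n - k) * v n) \<longlongrightarrow>
       (\<Sum>n=1..m. \<Sum>k=0..n-1. lambda_weight \<gamma> k * v (n - k) * v n)) (at_left 1)"
      by simp
    show "\<forall>\<^sub>F r in at_left (1::real).
        0 \<le> (\<Sum>n=1..m. \<Sum>k=0..n-1. lambda_weight \<gamma> k * r ^ k * v (n - k) * v n)"
      using eventually_at_left_real[OF zero_less_one] by eventually_elim (use damped in auto)
  qed simp
qed

section \<open>Decay of the space weights\<close>

lemma space_weight_uminus: "space_weight \<beta> (- k) = space_weight \<beta> k"
  unfolding space_weight_def by (simp add: power_int_minus power_int_minus_left mult_ac)

lemma space_weight_0: "space_weight \<beta> 0 = Gamma (\<beta> + 1) / (Gamma (\<beta> / 2 + 1))\<^sup>2"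
  unfolding space_weight_def by (simp add: rGamma_inverse_Gamma power2_eq_square field_simps)

lemma space_weight_rec:
  "(\<beta> / 2 + of_int k + 1) * space_weight \<beta> (k + 1) = (of_int k - \<beta> / 2) * space_weight \<beta> k"
proof -
  have 1: "rGamma (\<beta> / 2 - of_int (k + 1) + 1) = (\<beta> / 2 - of_int k) * rGamma (\<beta> / 2 - of_int k + 1)"
    using rGamma_plus1[of "\<beta> / 2 - of_int k :: real"] by (simp add: algebra_simps)
  have 2: "rGamma (\<beta> / 2 + of_int k + 1)
      = (\<beta> / 2 + of_int k + 1) * rGamma (\<beta> / 2 + of_int (k + 1) + 1)"
    using rGamma_plus1[of "\<beta> / 2 + of_int k + 1 :: real"] by (simp add: algebra_simps)
  have 3: "(- 1 :: real) powi (k + 1) = - ((- 1) powi k)"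
    by (simp add: power_int_add)
  show ?thesis
    unfolding space_weight_def 1 2 3 by (simp only: minus_mult_left[symmetric] mult_ac)
      (simp only: minus_mult_right left_diff_distrib right_diff_distrib minus_diff_eq mult_ac)
qed

lemma space_weight_0_pos: "0 < \<beta> \<Longrightarrow> 0 < space_weight \<beta> 0"
  unfolding space_weight_0 by (intro divide_pos_pos zero_less_power) (simp_all add: Gamma_real_pos)

lemma space_weight_nat_rec:
  assumes "0 < \<beta>"
  shows "space_weight \<beta> (int (Suc n)) = (real n - \<beta> / 2) / (real n + 1 + \<beta> / 2) * space_weight \<beta> (int n)"
proof -
  have "\<beta> / 2 + real n + 1 > 0" using assms by simp
  then show ?thesis
    using space_weight_rec[of \<beta> "int n"] by (simp add: field_simps)
qed

lemma space_weight_1_neg: "0 < \<beta> \<Longrightarrow> space_weight \<beta> 1 < 0"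
  using space_weight_nat_rec[of \<beta> 0] space_weight_0_pos[of \<beta>]
  by (simp add: divide_neg_pos mult_neg_pos)

lemma space_weight_nonpos:
  assumes "0 < \<beta>" "\<beta> \<le> 2" "k \<noteq> 0"
  shows "space_weight \<beta> k \<le> 0"
proof -
  have *: "space_weight \<beta> (int (Suc n)) \<le> 0" for n
  proof (induction n)
    case 0
    then show ?case using space_weight_1_neg[of \<beta>] assms by simp
  next
    case (Suc n)
    have "0 \<le> (real (Suc n) - \<beta> / 2) / (real (Suc n) + 1 + \<beta> / 2)"
      using assms by (intro divide_nonneg_nonneg) auto
    then show ?case
      unfolding space_weight_nat_rec[OF assms(1), of "Suc n"]
      using Suc mult_nonneg_nonpos by blast
  qed
  show ?thesis
  proof (cases "k > 0")
    case True
    then show ?thesis using *[of "nat k - 1"] by (simp add: of_nat_diff)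
  next
    case False
    then show ?thesis using *[of "nat (- k) - 1"] assms(3) space_weight_uminus[of \<beta> k]
      by (simp add: of_nat_diff)
  qed
qed

text \<open>
  For \<open>0 < \<beta> \<le> 2\<close>, this is the sum of the space weights with index at most \<open>k\<close>. Since all weights sum
  to \<open>0\<close> and only the one at \<open>0\<close> is positive, for \<open>k \<ge> 0\<close> it is also the sum of \<open>\<bar>space_weight \<beta> j\<bar>\<close> over \<open>j > k\<close>,
  hence the name. The closed form comes from Pascal's rule for the generalised binomial
  coefficients; with it, no infinite sum has to be handled.
\<close>

definition space_weight_tail :: "real \<Rightarrow> int \<Rightarrow> real" where
  "space_weight_tail \<beta> k = (\<beta> / 2 - of_int k) / \<beta> * space_weight \<beta> k"

lemma space_weight_tail_prev:
  "space_weight_tail \<beta> (k - 1) = - (\<beta> / 2 + of_int k) / \<beta> * space_weight \<beta> k"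
  using space_weight_rec[of \<beta> "k - 1"]
  by (simp add: space_weight_tail_def algebra_simps)

lemma space_weight_tail_uminus: "space_weight_tail \<beta> (- k) = - space_weight_tail \<beta> (k - 1)"
  unfolding space_weight_tail_prev
  by (simp add: space_weight_tail_def space_weight_uminus field_simps)

lemma space_weight_tail_diff:
  "\<beta> \<noteq> 0 \<Longrightarrow> space_weight_tail \<beta> k - space_weight_tail \<beta> (k - 1) = space_weight \<beta> k"
  unfolding space_weight_tail_prev by (simp add: space_weight_tail_def field_simps)

lemma space_weight_tail_Suc:
  assumes "0 < \<beta>"
  shows "space_weight_tail \<beta> (int (Suc n))
    = (real (Suc n) - \<beta> / 2) / (real (Suc n) + \<beta> / 2) * space_weight_tail \<beta> (int n)"
proof -
  have cancel: "(\<beta> / 2 - c) / \<beta> * w = (c - \<beta> / 2) / (c + \<beta> / 2) * (- (\<beta> / 2 + c) / \<beta> * w)"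
    if "0 < c" for c w
    using that assms by (simp add: divide_simps) (simp add: algebra_simps)
  have "space_weight_tail \<beta> (int n)
      = - (\<beta> / 2 + real (Suc n)) / \<beta> * space_weight \<beta> (int (Suc n))"
    using space_weight_tail_prev[of \<beta> "int (Suc n)"] by simp
  moreover have "space_weight_tail \<beta> (int (Suc n))
      = (\<beta> / 2 - real (Suc n)) / \<beta> * space_weight \<beta> (int (Suc n))"
    unfolding space_weight_tail_def by simp
  ultimately show ?thesis
    using cancel[of "real (Suc n)" "space_weight \<beta> (int (Suc n))"] by (simp only: of_nat_0_less_iff zero_less_Suc)
qed

lemma space_weight_tail_nonneg:
  assumes "0 < \<beta>" "\<beta> \<le> 2"
  shows "0 \<le> space_weight_tail \<beta> (int n)"
proof (induction n)
  case 0
  then show ?case using assms space_weight_0_pos[of \<beta>] by (simp add: space_weight_tail_def)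
next
  case (Suc n)
  then show ?case
    unfolding space_weight_tail_Suc[OF assms(1)] using assms
    by (intro mult_nonneg_nonneg divide_nonneg_nonneg) auto
qed

lemma space_weight_tail_0_pos: "0 < \<beta> \<Longrightarrow> 0 < space_weight_tail \<beta> 0"
  using space_weight_0_pos[of \<beta>] by (simp add: space_weight_tail_def)

lemma space_weight_tail_antimono:
  assumes "0 < \<beta>" "\<beta> \<le> 2" "n \<le> n'"
  shows "space_weight_tail \<beta> (int n') \<le> space_weight_tail \<beta> (int n)"
  using assms(3)
proof (induction n' rule: dec_induct)
  case (step j)
  have "space_weight_tail \<beta> (int (Suc j)) \<le> space_weight_tail \<beta> (int j)"
    unfolding space_weight_tail_Suc[OF assms(1)]
    using assms space_weight_tail_nonneg[OF assms(1,2), of j]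
    by (intro mult_left_le_one_le) (auto simp: field_simps)
  with step show ?case by linarith
qed simp

text \<open>
  The sum over a row telescopes, and the reflection \<open>space_weight_tail_uminus\<close> turns its lower
  endpoint into a second tail.
\<close>

lemma sum_space_weight_row:
  assumes "\<beta> \<noteq> 0" "i \<in> {1..M-1}"
  shows "(\<Sum>j=1..M-1. space_weight \<beta> (int i - int j))
    = space_weight_tail \<beta> (int (i - 1)) + space_weight_tail \<beta> (int (M - i - 1))"
proof -
  have "(\<Sum>j=1..n. space_weight \<beta> (int i - int j))
    = space_weight_tail \<beta> (int i - 1) - space_weight_tail \<beta> (int i - int n - 1)" for n
  proof (induction n)
    case (Suc n)
    then show ?case
      using space_weight_tail_diff[OF assms(1), of "int i - int (Suc n)"] by (simp add: algebra_simps)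
  qed simp
  from this[of "M - 1"] show ?thesis
    using assms(2) space_weight_tail_uminus[of \<beta> "int M - int i"]
    by (cases M) (auto simp: of_nat_diff algebra_simps)
qed

text \<open>
  Bernoulli's inequality for an exponent in \<open>[0, 1]\<close>, as weighted arithmetic-geometric mean of \<open>x\<close> and
  \<open>1\<close>.
\<close>

lemma bernoulli_powr_le:
  fixes b x :: real
  assumes "0 \<le> b" "b \<le> 1" "0 < x"
  shows "x powr b \<le> 1 + b * (x - 1)"
proof -
  have "x powr b * 1 powr (1 - b) \<le> b * x + (1 - b) * 1"
    using assms by (intro Youngs_inequality_0) auto
  then show ?thesis by (simp add: algebra_simps)
qed

lemma ratio_powr_le:
  fixes b t :: real
  assumes "0 \<le> b" "b \<le> 1" "2 < t"
  shows "((t - 2) / t) powr b \<le> (t - b) / (t + b)"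
proof -
  have "((t - 2) / t) powr b \<le> 1 + b * ((t - 2) / t - 1)"
    using assms by (intro bernoulli_powr_le) auto
  also have "\<dots> = 1 - 2 * b / t" using assms by (simp add: field_simps)
  also have "\<dots> \<le> 1 - 2 * b / (t + b)"
    using assms by (intro diff_left_mono divide_left_mono) auto
  also have "\<dots> = (t - b) / (t + b)" using assms by (simp add: field_simps)
  finally show ?thesis .
qed

text \<open>
  By \<open>ratio_powr_le\<close>, the quotients of consecutive tails are at least \<open>((j - 2) / j)\<^sup>b\<close> with
  \<open>b = \<beta>/2\<close>. The product of these over \<open>j = 4..n\<close> telescopes to \<open>(2 \<cdot> 3 / ((n - 1) n))\<^sup>b\<close>. Starting the
  product at \<open>j = 3\<close> instead would give too small a constant for \<open>c_star_le_tail\<close>.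
\<close>

lemma space_weight_tail_decay:
  assumes "0 < \<beta>" "\<beta> \<le> 2" "3 \<le> n"
  shows "(6 / ((real n - 1) * real n)) powr (\<beta> / 2) * space_weight_tail \<beta> 3 \<le> space_weight_tail \<beta> (int n)"
  using assms(3)
proof (induction n rule: dec_induct)
  case (step n)
  let ?b = "\<beta> / 2"
  \<comment> \<open>One step of the telescoping product.\<close>
  have split: "(6 / ((real (Suc n) - 1) * real (Suc n)))
      = (real (Suc n) - 2) / real (Suc n) * (6 / ((real n - 1) * real n))"
    using step.hyps by (simp add: divide_simps)
  have "(6 / ((real (Suc n) - 1) * real (Suc n))) powr ?b * space_weight_tail \<beta> 3
    = ((real (Suc n) - 2) / real (Suc n)) powr ?b * ((6 / ((real n - 1) * real n)) powr ?b * space_weight_tail \<beta> 3)"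
    unfolding split powr_mult by (rule mult.assoc)
  also have "\<dots> \<le> ((real (Suc n) - 2) / real (Suc n)) powr ?b * space_weight_tail \<beta> (int n)"
    by (intro mult_left_mono step.IH) simp
  also have "\<dots> \<le> (real (Suc n) - ?b) / (real (Suc n) + ?b) * space_weight_tail \<beta> (int n)"
    using assms step.hyps by (intro mult_right_mono ratio_powr_le space_weight_tail_nonneg) auto
  also have "\<dots> = space_weight_tail \<beta> (int (Suc n))" 
    by (rule space_weight_tail_Suc[OF assms(1), symmetric])
  finally show ?case .
qed simp

text \<open>
  The rational factor in \<open>r_const\<close> is the quotient of the space weights at \<open>3\<close> and \<open>0\<close>, up to sign.
\<close>

lemma c_star_eq_tail:
  assumes "0 < \<beta>"
  shows "c_star \<beta> = 2 * exp (- 2) * (3 + \<beta> / 2) powr \<beta> * space_weight_tail \<beta> 2"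
proof -
  have s1: "space_weight \<beta> 1 = - \<beta> / (2 + \<beta>) * space_weight \<beta> 0"
    using space_weight_nat_rec[OF assms, of 0] assms by (simp add: field_simps)
  have s2: "space_weight \<beta> 2 = (2 - \<beta>) / (4 + \<beta>) * space_weight \<beta> 1"
    using space_weight_nat_rec[OF assms, of 1] assms by (simp add: field_simps)
  have p: "(3 + \<beta> / 2) powr (\<beta> + 1) = (3 + \<beta> / 2) powr \<beta> * ((6 + \<beta>) / 2)"
    using assms by (simp add: powr_add field_simps)
  have "c_star \<beta> = 2 / \<beta> * (exp (- 2) * (((4 - \<beta>) * (2 - \<beta>) * \<beta>) / ((6 + \<beta>) * (4 + \<beta>) * (2 + \<beta>)))
       * space_weight \<beta> 0 * ((3 + \<beta> / 2) powr \<beta> * ((6 + \<beta>) / 2)))"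
    unfolding c_star_def r_const_def space_weight_0 p ..
  also have "\<dots> = 2 * exp (- 2) * (3 + \<beta> / 2) powr \<beta> * space_weight_tail \<beta> 2"
    unfolding space_weight_tail_def s1 s2 using assms by (simp add: divide_simps) (simp add: algebra_simps)
  finally show ?thesis .
qed

lemma sixteen_thirds_le_exp_2: "16 / 3 \<le> exp (2::real)"
proof -
  have "(1 + 1 / 4) ^ 8 \<le> exp (1 / 4 :: real) ^ 8"
    by (intro power_mono exp_ge_add_one_self) auto
  also have "\<dots> = exp 2" by (simp flip: exp_of_nat_mult)
  finally show ?thesis by (simp add: power_divide)
qed

text \<open>
  By \<open>c_star_eq_tail\<close>, this is \<open>(3 + b)\<^sup>\<beta> T\<^sub>2 \<le> e\<^sup>2 (n + 2)\<^sup>\<beta> T\<^sub>n\<close>, where \<open>T\<close> denotes the tails and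
  \<open>b = \<beta>/2\<close>. For \<open>n \<le> 2\<close> it holds because \<open>T\<close> decreases, \<open>3 + b \<le> 2 (n + 2)\<close> and
  \<open>2\<^sup>\<beta> \<le> e\<^sup>2\<close>. For \<open>n \<ge> 3\<close> the decay
  estimate leaves the factor \<open>2 (16/6)\<^sup>b \<le> 16/3\<close>, which \<open>e\<^sup>2\<close> absorbs.
\<close>

lemma c_star_le_tail:
  assumes "0 < \<beta>" "\<beta> \<le> 2"
  shows "c_star \<beta> * real (n + 2) powr (- \<beta>) \<le> 2 * space_weight_tail \<beta> (int n)"
proof -
  let ?T = "\<lambda>n::nat. space_weight_tail \<beta> (int n)" and ?b = "\<beta> / 2"
  have nonneg: "0 \<le> ?T k" for k by (rule space_weight_tail_nonneg[OF assms])
  have main: "(3 + ?b) powr \<beta> * ?T 2 \<le> exp 2 * (real (n + 2) powr \<beta> * ?T n)"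
  proof (cases "n \<le> 2")
    case True
    have "(3 + ?b) powr \<beta> \<le> (2 * real (n + 2)) powr \<beta>"
      using assms by (intro powr_mono2) auto
    also have "\<dots> = 2 powr \<beta> * real (n + 2) powr \<beta>" by (rule powr_mult)
    also have "(2::real) powr \<beta> \<le> 2 powr 2" using assms by (intro powr_mono) auto
    also have "(2::real) powr 2 \<le> exp 2" using sixteen_thirds_le_exp_2 by simp
    finally have "(3 + ?b) powr \<beta> \<le> exp 2 * real (n + 2) powr \<beta>" by simp
    then have "(3 + ?b) powr \<beta> * ?T 2 \<le> (exp 2 * real (n + 2) powr \<beta>) * ?T n"
      by (rule mult_mono[OF _ space_weight_tail_antimono[OF assms True] _ nonneg]) simp
    then show ?thesis by (simp only: mult.assoc)
  next
    case False
    have sq: "x powr \<beta> = (x\<^sup>2) powr ?b" if "x > 0" for x :: real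
      using that by (simp add: powr_powr flip: powr_numeral)
    have T3: "?T 2 \<le> 2 * ?T 3"
    proof -
      have "1 / 2 \<le> (3 - ?b) / (3 + ?b)" using assms by (simp add: field_simps)
      from mult_right_mono[OF this nonneg[of 2]] show ?thesis
        using space_weight_tail_Suc[OF assms(1), of 2] by simp
    qed
    have "(3 + ?b) powr \<beta> \<le> 4 powr \<beta>" using assms by (intro powr_mono2) auto
    also have "\<dots> = (8 / 3 * 6) powr ?b" by (subst sq) simp_all
    also have "\<dots> = (8 / 3) powr ?b * 6 powr ?b" by (simp only: powr_mult)
    also have "(8 / 3 :: real) powr ?b \<le> (8 / 3) powr 1" using assms by (intro powr_mono) auto
    finally have "(3 + ?b) powr \<beta> \<le> 8 / 3 * 6 powr ?b" by simp
    then have "(3 + ?b) powr \<beta> * ?T 2 \<le> (8 / 3 * 6 powr ?b) * (2 * ?T 3)"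
      by (rule mult_mono[OF _ T3 _ nonneg]) simp
    also have "\<dots> = 16 / 3 * (6 powr ?b * ?T 3)" by simp
    also have "\<dots> \<le> exp 2 * (6 powr ?b * ?T 3)"
      by (intro mult_right_mono sixteen_thirds_le_exp_2 mult_nonneg_nonneg powr_ge_zero nonneg)
    also have "6 powr ?b * ?T 3 \<le> real (n + 2) powr \<beta> * ?T n"
    proof -
      have "6 \<le> real (n + 2) ^ 2 * (6 / ((real n - 1) * real n))"
        using False by (simp add: field_simps power2_eq_square)
      then have "6 powr ?b \<le> (real (n + 2) ^ 2 * (6 / ((real n - 1) * real n))) powr ?b"
        using assms by (intro powr_mono2) auto
      also have "\<dots> = real (n + 2) powr \<beta> * (6 / ((real n - 1) * real n)) powr ?b"
        unfolding powr_mult by (subst sq[of "real (n + 2)"]) simp_all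
      finally have "6 powr ?b * ?T 3 \<le> real (n + 2) powr \<beta> * (6 / ((real n - 1) * real n)) powr ?b * ?T 3"
        using nonneg[of 3] by (intro mult_right_mono)
      also have "\<dots> \<le> real (n + 2) powr \<beta> * ?T n"
        using space_weight_tail_decay[OF assms, of n] False by (simp add: mult.assoc mult_left_mono)
      finally show ?thesis .
    qed
    finally show ?thesis by simp
  qed
  have "c_star \<beta> * real (n + 2) powr (- \<beta>)
     = 2 * exp (- 2) * real (n + 2) powr (- \<beta>) * ((3 + ?b) powr \<beta> * ?T 2)"
    using c_star_eq_tail[OF assms(1)] by simp
  also have "\<dots> \<le> 2 * exp (- 2) * real (n + 2) powr (- \<beta>) * (exp 2 * (real (n + 2) powr \<beta> * ?T n))"
    using main by (intro mult_left_mono) auto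
  also have "\<dots> = 2 * (exp (- 2) * exp 2) * (real (n + 2) powr (- \<beta>) * real (n + 2) powr \<beta>) * ?T n"
    by (simp only: mult_ac)
  also have "\<dots> = 2 * ?T n" by (simp flip: exp_add powr_add)
  finally show ?thesis .
qed

lemma c_star_pos: "0 < \<beta> \<Longrightarrow> \<beta> < 2 \<Longrightarrow> 0 < c_star \<beta>"
  unfolding c_star_def r_const_def
  by (intro mult_pos_pos divide_pos_pos zero_less_power) (simp_all add: Gamma_real_pos)

lemma c_star_2: "c_star 2 = 0"
  by (simp add: c_star_def r_const_def)

section \<open>Coercivity and definiteness of the space form\<close>

definition toeplitz_form :: "nat \<Rightarrow> (int \<Rightarrow> real) \<Rightarrow> (nat \<Rightarrow> real) \<Rightarrow> (nat \<Rightarrow> real) \<Rightarrow> real" where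
  "toeplitz_form M a v w = (\<Sum>i=1..M-1. \<Sum>j=1..M-1. a (int i - int j) * v i * w j)"

text \<open>
  The identity behind diagonal dominance: \<open>2 v\<^sub>i v\<^sub>j = v\<^sub>i\<^sup>2 + v\<^sub>j\<^sup>2 - (v\<^sub>i - v\<^sub>j)\<^sup>2\<close>.
\<close>

lemma toeplitz_form_dominance:
  assumes "\<And>k. a (- k) = a k"
  shows "toeplitz_form M a v v = (\<Sum>i=1..M-1. (\<Sum>j=1..M-1. a (int i - int j)) * (v i)\<^sup>2)
     + (\<Sum>i=1..M-1. \<Sum>j=1..M-1. - a (int i - int j) / 2 * (v i - v j)\<^sup>2)"
proof -
  let ?I = "{1..M-1}"
  have sw: "(\<Sum>i\<in>?I. \<Sum>j\<in>?I. a (int i - int j) * (v j)\<^sup>2) = (\<Sum>i\<in>?I. \<Sum>j\<in>?I. a (int i - int j) * (v i)\<^sup>2)"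
    by (subst sum.swap) (use assms[of "int _ - int _"] in simp)
  have "(\<Sum>i\<in>?I. \<Sum>j\<in>?I. - a (int i - int j) / 2 * (v i - v j)\<^sup>2)
     = toeplitz_form M a v v - (\<Sum>i\<in>?I. \<Sum>j\<in>?I. a (int i - int j) * (v i)\<^sup>2) / 2
        - (\<Sum>i\<in>?I. \<Sum>j\<in>?I. a (int i - int j) * (v j)\<^sup>2) / 2"
    unfolding toeplitz_form_def sum_divide_distrib sum_subtractf[symmetric]
    by (intro sum.cong refl) (simp add: power2_eq_square field_simps)
  then show ?thesis unfolding sw by (simp add: sum_distrib_right)
qed

text \<open>
  The off-diagonal part in \<open>toeplitz_form_dominance\<close> is nonnegative. The two tails in a row sum have
  indices at most \<open>M - 2\<close>, and tails decrease, so the row sum is at least twice the tail at \<open>M - 2\<close>,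
  which \<open>c_star_le_tail\<close> bounds from below.
\<close>

lemma space_form_coercive:
  assumes "0 < \<beta>" "\<beta> \<le> 2"
  shows "c_star \<beta> * real M powr (- \<beta>) * (\<Sum>i=1..M-1. (v i)\<^sup>2) \<le> toeplitz_form M (space_weight \<beta>) v v"
proof -
  have row: "c_star \<beta> * real M powr (- \<beta>) \<le> (\<Sum>j=1..M-1. space_weight \<beta> (int i - int j))"
    if i: "i \<in> {1..M-1}" for i
  proof -
    have "c_star \<beta> * real M powr (- \<beta>) \<le> 2 * space_weight_tail \<beta> (int (M - 2))"
    proof -
      have "M - 2 + 2 = M" using i by auto
      then show ?thesis using c_star_le_tail[OF assms, of "M - 2"] by simp
    qed
    also have "\<dots> \<le> space_weight_tail \<beta> (int (i - 1)) + space_weight_tail \<beta> (int (M - i - 1))"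
    proof -
      have "i - 1 \<le> M - 2" "M - i - 1 \<le> M - 2" using i by auto
      from this[THEN space_weight_tail_antimono[OF assms]] show ?thesis by linarith
    qed
    finally show ?thesis using sum_space_weight_row[of \<beta> i M] i assms by simp
  qed
  have "0 \<le> (\<Sum>i=1..M-1. \<Sum>j=1..M-1. - space_weight \<beta> (int i - int j) / 2 * (v i - v j)\<^sup>2)"
  proof (intro sum_nonneg)
    fix i j
    show "0 \<le> - space_weight \<beta> (int i - int j) / 2 * (v i - v j)\<^sup>2"
      using space_weight_nonpos[OF assms, of "int i - int j"]
      by (cases "i = j") (auto intro: mult_nonpos_nonneg)
  qed
  moreover have "c_star \<beta> * real M powr (- \<beta>) * (\<Sum>i=1..M-1. (v i)\<^sup>2)
      \<le> (\<Sum>i=1..M-1. (\<Sum>j=1..M-1. space_weight \<beta> (int i - int j)) * (v i)\<^sup>2)"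
    unfolding sum_distrib_left by (intro sum_mono mult_right_mono row) auto
  ultimately show ?thesis
    unfolding toeplitz_form_dominance[of "space_weight \<beta>", OF space_weight_uminus] by linarith
qed

text \<open>
  This covers \<open>\<beta> = 2\<close>, where the coercivity constant is \<open>0\<close>. If the form is at most \<open>0\<close>, then each of the
  nonnegative terms vanishes in \<open>toeplitz_form_dominance\<close>. The first row sum is positive, hence \<open>v 1 = 0\<close>; the weight at \<open>1\<close> is
  negative, hence neighbouring values agree.
\<close>

lemma space_form_definite:
  assumes "0 < \<beta>" "\<beta> \<le> 2" "toeplitz_form M (space_weight \<beta>) v v \<le> 0" "i \<in> {1..M-1}"
  shows "v i = 0"
proof -
  let ?I = "{1..M-1}"
  let ?R = "\<lambda>i. (\<Sum>j=1..M-1. space_weight \<beta> (int i - int j)) * (v i)\<^sup>2"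
  let ?D = "\<lambda>i j. - space_weight \<beta> (int i - int j) / 2 * (v i - v j)\<^sup>2"
  have row: "(\<Sum>j=1..M-1. space_weight \<beta> (int i - int j)) \<ge> space_weight_tail \<beta> (int (i - 1))"
    if "i \<in> ?I" for i
    using sum_space_weight_row[OF _ that, of \<beta>] space_weight_tail_nonneg[OF assms(1,2)] assms(1) by simp
  have R: "0 \<le> ?R i" if "i \<in> ?I" for i
    using row[OF that] space_weight_tail_nonneg[OF assms(1,2), of "i - 1"] by simp
  have D: "0 \<le> ?D i j" for i j
    using space_weight_nonpos[OF assms(1,2), of "int i - int j"]
    by (cases "i = j") (auto intro: mult_nonpos_nonneg)
  have "sum ?R ?I + (\<Sum>i\<in>?I. \<Sum>j\<in>?I. ?D i j) \<le> 0"
    using assms(3) toeplitz_form_dominance[of "space_weight \<beta>", OF space_weight_uminus] by simp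
  moreover have "0 \<le> sum ?R ?I" using R by (intro sum_nonneg) auto
  moreover have "0 \<le> (\<Sum>i\<in>?I. \<Sum>j\<in>?I. ?D i j)" by (intro sum_nonneg D)
  ultimately have R_sum: "sum ?R ?I = 0" and D_sum: "(\<Sum>i\<in>?I. \<Sum>j\<in>?I. ?D i j) = 0"
    by linarith+
  have R0: "\<forall>i\<in>?I. ?R i = 0"
    using R_sum by (rule iffD1[OF sum_nonneg_eq_0_iff, rotated 2]) (simp, erule R)
  have rows: "\<forall>i\<in>?I. (\<Sum>j\<in>?I. ?D i j) = 0"
    using D_sum by (rule iffD1[OF sum_nonneg_eq_0_iff, rotated 2]) (simp, rule sum_nonneg, rule D)
  have D0: "\<forall>i\<in>?I. \<forall>j\<in>?I. ?D i j = 0"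
  proof
    fix i assume "i \<in> ?I"
    with rows have "(\<Sum>j\<in>?I. ?D i j) = 0" by (rule bspec)
    then show "\<forall>j\<in>?I. ?D i j = 0"
      by (rule iffD1[OF sum_nonneg_eq_0_iff, rotated 2]) (simp, rule D)
  qed
  from assms(4) have "i \<ge> 1" by simp
  then have "i < M \<longrightarrow> v i = 0"
  proof (induction i rule: dec_induct)
    case base
    show ?case
    proof
      assume "1 < M"
      then have "1 \<in> ?I" by auto
      with row[of 1] bspec[OF R0, of 1] space_weight_tail_0_pos[OF assms(1)] show "v 1 = 0" by auto
    qed
  next
    case (step i)
    show ?case
    proof
      assume "Suc i < M"
      with step have "?D (Suc i) i = 0" "v i = 0"
        using bspec[OF bspec[OF D0, of "Suc i"], of i] by auto
      then show "v (Suc i) = 0" using space_weight_1_neg[OF assms(1)] by auto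
    qed
  qed
  then show ?thesis using assms(4) by auto
qed

section \<open>The symbol of the space weights\<close>

text \<open>
  The integrand is the derivative of \<open>2 sin (x/2)\<^sup>\<beta>\<^sup>+\<^sup>1 cos ((k + 1/2) x)\<close>, which vanishes at both ends.
  The resulting recurrence for the moments is the one in \<open>space_weight_rec\<close>.
\<close>

lemma sin_powr_moment_rec:
  assumes "0 < \<beta>"
  shows "((\<lambda>x. sin (x / 2) powr \<beta> * ((\<beta> / 2 + real k + 1) * cos (real (Suc k) * x)
             - (real k - \<beta> / 2) * cos (real k * x))) has_integral 0) {0..pi}"
proof -
  define y where "y = (\<lambda>x. (real k + 1 / 2) * x)"
  let ?F = "\<lambda>x. 2 * sin (x / 2) powr (\<beta> + 1) * cos (y x)"
  let ?f = "\<lambda>x. sin (x / 2) powr \<beta> * ((\<beta> / 2 + real k + 1) * cos (real (Suc k) * x)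
             - (real k - \<beta> / 2) * cos (real k * x))"
  have "(?f has_integral (?F pi - ?F 0)) {0..pi}"
  proof (rule fundamental_theorem_of_calculus_interior)
    show "continuous_on {0..pi} ?F"
      unfolding y_def using assms
      by (intro continuous_intros continuous_on_powr') (auto intro: sin_ge_zero)
    fix x assume x: "x \<in> {0<..<pi}"
    then have s: "0 < sin (x / 2)" by (intro sin_gt_zero) auto
    have c1: "cos (real (Suc k) * x) = cos (y x) * cos (x / 2) - sin (y x) * sin (x / 2)"
      unfolding cos_add[symmetric] by (simp add: y_def algebra_simps)
    have c2: "cos (real k * x) = cos (y x) * cos (x / 2) + sin (y x) * sin (x / 2)"
      unfolding cos_diff[symmetric] by (simp add: y_def algebra_simps)
    have p: "sin (x / 2) powr (\<beta> + 1) = sin (x / 2) powr \<beta> * sin (x / 2)"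
      using s by (simp add: powr_add)
    have "((\<lambda>x. sin (x / 2)) has_real_derivative cos (x / 2) / 2) (at x)"
      by (auto intro!: derivative_eq_intros)
    from DERIV_fun_powr[OF this s, of "\<beta> + 1"]
    have "((\<lambda>x. sin (x / 2) powr (\<beta> + 1)) has_real_derivative
        (\<beta> + 1) * sin (x / 2) powr \<beta> * (cos (x / 2) / 2)) (at x)"
      by simp
    moreover have "((\<lambda>x. cos (y x)) has_real_derivative - sin (y x) * (real k + 1 / 2)) (at x)"
      unfolding y_def by (auto intro!: derivative_eq_intros)
    ultimately have "(?F has_real_derivative
        2 * ((\<beta> + 1) * sin (x / 2) powr \<beta> * (cos (x / 2) / 2) * cos (y x)
          + - sin (y x) * (real k + 1 / 2) * sin (x / 2) powr (\<beta> + 1))) (at x)"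
      unfolding mult.assoc[of 2] by (intro DERIV_cmult DERIV_mult)
    moreover have "2 * ((\<beta> + 1) * sin (x / 2) powr \<beta> * (cos (x / 2) / 2) * cos (y x)
          + - sin (y x) * (real k + 1 / 2) * sin (x / 2) powr (\<beta> + 1)) = ?f x"
      unfolding c1 c2 p by (simp add: algebra_simps)
    ultimately show "(?F has_vector_derivative ?f x) (at x)"
      by (simp add: has_real_derivative_iff_has_vector_derivative)
  qed simp
  moreover have "cos (y pi) = 0"
    unfolding y_def by (simp add: distrib_right cos_add)
  ultimately show ?thesis using assms by simp
qed

lemma sin_powr_moment_integrable:
  assumes "0 < \<beta>"
  shows "(\<lambda>x. sin (x / 2) powr \<beta> * cos (c * x)) integrable_on {0..pi}"
  using assms by (intro integrable_continuous_real continuous_intros continuous_on_powr')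
    (auto intro: sin_ge_zero)

lemma legendre_duplication_half:
  assumes "0 < (\<beta>::real)"
  shows "Gamma (\<beta> / 2 + 1 / 2) * Gamma (\<beta> / 2 + 1) = 2 powr (- \<beta>) * sqrt pi * Gamma (\<beta> + 1)"
proof -
  have nn: "complex_of_real t \<notin> \<int>\<^sub>\<le>\<^sub>0" if "t > 0" for t
    using that by (auto simp: nonpos_Ints_def) (metis not_less of_int_0_less_iff of_real_eq_iff of_real_of_int_eq)
  let ?z = "\<beta> / 2 + 1 / 2"
  have eqs: "complex_of_real ?z + 1 / 2 = of_real (\<beta> / 2 + 1)" "2 * complex_of_real ?z = of_real (\<beta> + 1)"
    "(1 - complex_of_real (\<beta> + 1)) * of_real (ln 2) = of_real (- \<beta> * ln 2)"
    by (simp_all add: field_simps)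
  have "Gamma (complex_of_real ?z) * Gamma (complex_of_real ?z + 1 / 2)
    = exp ((1 - 2 * complex_of_real ?z) * of_real (ln 2)) * of_real (sqrt pi) * Gamma (2 * complex_of_real ?z)"
    by (rule Gamma_legendre_duplication; (unfold eqs)?; rule nn) (use assms in auto)
  then have "complex_of_real (Gamma ?z * Gamma (\<beta> / 2 + 1))
     = of_real (exp (- \<beta> * ln 2) * sqrt pi * Gamma (\<beta> + 1))"
    by (simp only: eqs Gamma_complex_of_real exp_of_real flip: of_real_mult)
  then show ?thesis unfolding of_real_eq_iff by (simp add: powr_def)
qed

text \<open>
  Substitution \<open>t = sin (x/2)\<^sup>2\<close> in the Beta integral. The factor \<open>cos (x/2)\<^sup>2\<close> keeps the transformed
  integrand continuous at \<open>t = 1\<close>; without it an improper integral would arise.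
\<close>

lemma sin_powr_cos_sq_integral:
  assumes "1 < \<beta>"
  shows "((\<lambda>x. sin (x / 2) powr \<beta> * (cos (x / 2))\<^sup>2) has_integral
     Beta (\<beta> / 2 + 1 / 2) (3 / 2)) {0..pi}"
proof -
  let ?f = "\<lambda>t. t powr (\<beta> / 2 + 1 / 2 - 1) * (1 - t) powr (3 / 2 - 1)"
  let ?g = "\<lambda>x. (sin (x / 2))\<^sup>2"
  have "((\<lambda>x. (sin (x / 2) * cos (x / 2)) *\<^sub>R ?f (?g x)) has_integral
       (integral {?g 0..?g pi} ?f)) {0..pi}"
  proof (rule has_integral_substitution)
    show "continuous_on {0..1} ?f"
      using assms by (intro continuous_intros continuous_on_powr') auto
    show "?g ` {0..pi} \<subseteq> {0..1}" by (auto simp: abs_square_le_1)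
    show "(?g has_real_derivative sin (x / 2) * cos (x / 2)) (at x within {0..pi})" for x
      by (auto intro!: derivative_eq_intros)
  qed (auto)
  also have "integral {?g 0..?g pi} ?f = Beta (\<beta> / 2 + 1 / 2) (3 / 2)"
    using has_integral_Beta_real[of "\<beta> / 2 + 1 / 2" "3 / 2"] assms by (simp add: integral_unique)
  finally have I: "((\<lambda>x. (sin (x / 2) * cos (x / 2)) *\<^sub>R ?f (?g x)) has_integral
       Beta (\<beta> / 2 + 1 / 2) (3 / 2)) {0..pi}" .
  show ?thesis
  proof (rule has_integral_eq[OF _ I])
    fix x assume x: "x \<in> {0..pi}"
    have s: "0 \<le> sin (x / 2)" using x by (intro sin_ge_zero) auto
    have c: "0 \<le> cos (x / 2)" using x by (intro cos_ge_zero) auto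
    have "1 - ?g x = (cos (x / 2))\<^sup>2" by (simp add: cos_squared_eq)
    then have 1: "(1 - ?g x) powr (3 / 2 - 1) = cos (x / 2)"
      using c by (simp add: powr_half_sqrt)
    have 2: "sin (x / 2) * ?g x powr (\<beta> / 2 + 1 / 2 - 1) = sin (x / 2) powr \<beta>"
    proof (cases "sin (x / 2) = 0")
      case False
      then have s: "0 < sin (x / 2)" using s by simp
      have "?g x powr (\<beta> / 2 + 1 / 2 - 1) = sin (x / 2) powr (2 * (\<beta> / 2 + 1 / 2 - 1))"
        using s by (simp add: powr_powr flip: powr_numeral)
      then have "sin (x / 2) * ?g x powr (\<beta> / 2 + 1 / 2 - 1) = sin (x / 2) powr (1 + 2 * (\<beta> / 2 + 1 / 2 - 1))"
        unfolding powr_add using s by simp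
      then show ?thesis by (simp add: field_simps)
    qed (use assms in simp)
    have "(sin (x / 2) * cos (x / 2)) *\<^sub>R ?f (?g x)
      = (sin (x / 2) * ?g x powr (\<beta> / 2 + 1 / 2 - 1)) * cos (x / 2) * (1 - ?g x) powr (3 / 2 - 1)"
      by simp
    also have "\<dots> = sin (x / 2) powr \<beta> * (cos (x / 2))\<^sup>2"
      unfolding 1 2 by (simp add: power2_eq_square)
    finally show "(sin (x / 2) * cos (x / 2)) *\<^sub>R ?f (?g x) = sin (x / 2) powr \<beta> * (cos (x / 2))\<^sup>2" .
  qed
qed

text \<open>
  Moments and weights obey the same first-order recurrence, so only \<open>k = 0\<close> needs an evaluation. There
  \<open>2 cos (x/2)\<^sup>2 = 1 + cos x\<close> relates the sum of the moments \<open>0\<close> and \<open>1\<close> to a Beta value, the recurrence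
  eliminates the moment \<open>1\<close>, and Legendre's duplication formula simplifies the Gamma factors.
\<close>

lemma space_weight_eq_moment_half:
  assumes "1 < \<beta>"
  shows "integral {0..pi} (\<lambda>x. (2 * sin (x / 2)) powr \<beta> * cos (real k * x)) = pi * space_weight \<beta> (int k)"
proof -
  have b: "0 < \<beta>" using assms by simp
  define I where "I = (\<lambda>k::nat. integral {0..pi} (\<lambda>x. sin (x / 2) powr \<beta> * cos (real k * x)))"
  have hI: "((\<lambda>x. sin (x / 2) powr \<beta> * cos (real k * x)) has_integral I k) {0..pi}" for k
    unfolding I_def by (intro integrable_integral sin_powr_moment_integrable b)
  have rec: "(\<beta> / 2 + real k + 1) * I (Suc k) = (real k - \<beta> / 2) * I k" for k
  proof -
    have "((\<lambda>x. (\<beta> / 2 + real k + 1) * (sin (x / 2) powr \<beta> * cos (real (Suc k) * x))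
       - (real k - \<beta> / 2) * (sin (x / 2) powr \<beta> * cos (real k * x))) has_integral
       ((\<beta> / 2 + real k + 1) * I (Suc k) - (real k - \<beta> / 2) * I k)) {0..pi}"
      by (intro has_integral_diff has_integral_mult_right hI)
    moreover have "(\<lambda>x. (\<beta> / 2 + real k + 1) * (sin (x / 2) powr \<beta> * cos (real (Suc k) * x))
       - (real k - \<beta> / 2) * (sin (x / 2) powr \<beta> * cos (real k * x)))
       = (\<lambda>x. sin (x / 2) powr \<beta> * ((\<beta> / 2 + real k + 1) * cos (real (Suc k) * x)
             - (real k - \<beta> / 2) * cos (real k * x)))"
      by (rule ext) (simp add: algebra_simps)
    ultimately show ?thesis
      using has_integral_unique[OF _ sin_powr_moment_rec[OF b, of k]] by fastforce
  qed
  have main: "2 powr \<beta> * I k = pi * space_weight \<beta> (int k)"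
  proof (induction k)
    case 0
    have "((\<lambda>x. (sin (x / 2) powr \<beta> * cos (real 0 * x) + sin (x / 2) powr \<beta> * cos (real 1 * x)) / 2)
        has_integral ((I 0 + I 1) / 2)) {0..pi}"
      by (intro has_integral_divide has_integral_add hI)
    moreover have "(sin (x / 2) powr \<beta> * cos (real 0 * x) + sin (x / 2) powr \<beta> * cos (real 1 * x)) / 2
       = sin (x / 2) powr \<beta> * (cos (x / 2))\<^sup>2" for x :: real
    proof -
      have c: "cos x = 2 * (cos (x / 2))\<^sup>2 - 1" using cos_double_cos[of "x / 2"] by simp
      show ?thesis by (simp add: c algebra_simps)
    qed
    ultimately have "((\<lambda>x. sin (x / 2) powr \<beta> * (cos (x / 2))\<^sup>2) has_integral ((I 0 + I 1) / 2)) {0..pi}"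
      by simp
    then have B: "(I 0 + I 1) / 2 = Beta (\<beta> / 2 + 1 / 2) (3 / 2)"
      using sin_powr_cos_sq_integral[OF assms] has_integral_unique by blast
    have "(\<beta> / 2 + 1) * I 1 = - \<beta> / 2 * I 0" using rec[of 0] by simp
    then have "I 0 + I 1 = I 0 / (\<beta> / 2 + 1)" using b by (simp add: field_simps)
    with B have I0: "I 0 = 2 * (\<beta> / 2 + 1) * Beta (\<beta> / 2 + 1 / 2) (3 / 2)"
      using b by (simp add: field_simps)
    have G1: "Gamma (\<beta> / 2 + 1) > 0" using b by (intro Gamma_real_pos) auto
    have G32: "Gamma (3 / 2 :: real) = sqrt pi / 2"
    proof -
      have "(1 / 2 :: real) \<notin> \<int>\<^sub>\<le>\<^sub>0" using nonpos_Ints_nonpos[of "1 / 2 :: real"] by auto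
      from Gamma_plus1[OF this] show ?thesis by (simp add: Gamma_one_half_real)
    qed
    have G2: "Gamma (\<beta> / 2 + 1 / 2 + 3 / 2) = (\<beta> / 2 + 1) * Gamma (\<beta> / 2 + 1)"
    proof -
      have "\<beta> / 2 + 1 \<notin> \<int>\<^sub>\<le>\<^sub>0" using nonpos_Ints_nonpos[of "\<beta> / 2 + 1"] b by auto
      from Gamma_plus1[OF this] show ?thesis by (simp add: add_ac)
    qed
    have "2 powr \<beta> * I 0 = 2 powr \<beta> * (Gamma (\<beta> / 2 + 1 / 2) * Gamma (\<beta> / 2 + 1)) * sqrt pi / (Gamma (\<beta> / 2 + 1))\<^sup>2"
    proof -
      have "2 * D * (A * (s / 2) / (D * C)) = A * C * s / C\<^sup>2" if "D > 0" "C > 0" for A C D s :: real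
        using that by (simp add: power2_eq_square field_simps)
      from this[of "\<beta> / 2 + 1"] show ?thesis
        unfolding I0 Beta_def G32 G2 using b G1 by simp
    qed
    also have "\<dots> = pi * space_weight \<beta> 0"
      unfolding legendre_duplication_half[OF b] space_weight_0 by (simp add: powr_minus field_simps)
    finally show ?case by simp
  next
    case (Suc k)
    have "\<beta> / 2 + real k + 1 > 0" using b by simp
    moreover have "(\<beta> / 2 + real k + 1) * (2 powr \<beta> * I (Suc k)) = (\<beta> / 2 + real k + 1) * (pi * space_weight \<beta> (int (Suc k)))"
    proof -
      have "(\<beta> / 2 + real k + 1) * (2 powr \<beta> * I (Suc k)) = 2 powr \<beta> * ((\<beta> / 2 + real k + 1) * I (Suc k))"
        by simp
      also have "\<dots> = (real k - \<beta> / 2) * (2 powr \<beta> * I k)" unfolding rec by simp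
      also have "\<dots> = pi * ((\<beta> / 2 + of_int (int k) + 1) * space_weight \<beta> (int k + 1))"
        unfolding Suc space_weight_rec by simp
      finally show ?thesis by (simp add: add.commute)
    qed
    ultimately show ?case by simp
  qed
  have "((\<lambda>x. 2 powr \<beta> * (sin (x / 2) powr \<beta> * cos (real k * x))) has_integral 2 powr \<beta> * I k) {0..pi}"
    by (intro has_integral_mult_right hI)
  from integral_unique[OF this] show ?thesis
    unfolding main by (simp only: powr_mult mult.assoc)
qed

definition space_symbol :: "real \<Rightarrow> real \<Rightarrow> real" where
  "space_symbol \<beta> x = \<bar>2 * sin (x / 2)\<bar> powr \<beta>"

lemma has_integral_even:
  fixes f :: "real \<Rightarrow> real"
  assumes "(f has_integral I) {0..a}" "0 \<le> a" "\<And>x. f (- x) = f x"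
  shows "(f has_integral 2 * I) {-a..a}"
proof -
  have "((\<lambda>x. f (- x)) has_integral I) {-a..-0}"
    using assms(1) by (subst has_integral_reflect_real)
  then have "(f has_integral I) {-a..0}" using assms(3) by simp
  from has_integral_combine[OF _ _ this assms(1)] assms(2) show ?thesis by simp
qed

lemma space_weight_eq_moment:
  assumes "1 < \<beta>"
  shows "((\<lambda>x. space_symbol \<beta> x * cos (of_int k * x)) has_integral 2 * pi * space_weight \<beta> k) {-pi..pi}"
proof -
  have *: "((\<lambda>x. space_symbol \<beta> x * cos (real n * x)) has_integral 2 * pi * space_weight \<beta> (int n)) {-pi..pi}" for n
  proof -
    have "(\<lambda>x. (2 * sin (x / 2)) powr \<beta> * cos (real n * x)) integrable_on {0..pi}"
      using assms by (intro integrable_continuous_real continuous_intros continuous_on_powr')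
        (auto intro: sin_ge_zero)
    then have "((\<lambda>x. (2 * sin (x / 2)) powr \<beta> * cos (real n * x)) has_integral pi * space_weight \<beta> (int n)) {0..pi}"
      unfolding space_weight_eq_moment_half[OF assms, symmetric] by (rule integrable_integral)
    moreover have "(2 * sin (x / 2)) powr \<beta> = space_symbol \<beta> x" if "x \<in> {0..pi}" for x
      using that sin_ge_zero[of "x / 2"] by (simp add: space_symbol_def)
    ultimately have "((\<lambda>x. space_symbol \<beta> x * cos (real n * x)) has_integral pi * space_weight \<beta> (int n)) {0..pi}"
      by (subst has_integral_cong[where g = "\<lambda>x. (2 * sin (x / 2)) powr \<beta> * cos (real n * x)"]) auto
    from has_integral_even[OF this] show ?thesis by (simp add: space_symbol_def mult.assoc)
  qed
  show ?thesis
  proof (cases "k \<ge> 0")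
    case True
    then show ?thesis using *[of "nat k"] by simp
  next
    case False
    then show ?thesis using *[of "nat (- k)"] by (simp add: space_weight_uminus)
  qed
qed

lemma cmod_grid_fourier_sq:
  assumes "h > 0"
  shows "(cmod (grid_fourier h M v k))\<^sup>2 = h\<^sup>2 / (2 * pi) * trig_energy {1..M-1} v (h * k)"
proof -
  define S where "S = (\<Sum>j=1..M-1. complex_of_real (v j) * exp (- (\<i> * complex_of_real (k * (real j * h)))))"
  have "Re S = (\<Sum>j=1..M-1. v j * cos (real j * (h * k)))" "Im S = - (\<Sum>j=1..M-1. v j * sin (real j * (h * k)))"
    unfolding S_def Re_sum Im_sum sum_negf[symmetric]
    by (auto intro!: sum.cong simp: Re_exp Im_exp mult_ac)
  then have "(cmod S)\<^sup>2 = trig_energy {1..M-1} v (h * k)"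
    unfolding cmod_power2 trig_energy_def by simp
  moreover have "(cmod (grid_fourier h M v k))\<^sup>2 = (h / sqrt (2 * pi))\<^sup>2 * (cmod S)\<^sup>2"
    unfolding grid_fourier_def S_def[symmetric] norm_mult power_mult_distrib norm_of_real
    using assms by simp
  ultimately show ?thesis by (simp add: power_divide)
qed

lemma abs_two_sin_half_le: "\<bar>2 * sin (x / 2)\<bar> \<le> \<bar>x :: real\<bar>"
  using abs_sin_x_le_abs_x[of "x / 2"] by simp

text \<open>
  Both sides are integrals of the same trigonometric energy over \<open>[-\<pi>/h, \<pi>/h]\<close>, on the left with the
  weight \<open>\<bar>2 sin (h k / 2) / h\<bar>\<^sup>\<beta>\<close> and on the right with the larger weight \<open>\<bar>k\<bar>\<^sup>\<beta>\<close>.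
\<close>

lemma space_form_le_seminorm:
  assumes "1 < \<beta>" "h > 0"
  shows "h powr (- \<beta>) * (h * toeplitz_form M (space_weight \<beta>) v v) \<le> frac_seminorm_sq \<beta> h M v"
proof -
  let ?E = "trig_energy {1..M-1} v"
  have "((\<lambda>x. space_symbol \<beta> x * ?E x) has_integral
      (\<Sum>i=1..M-1. \<Sum>j=1..M-1. v i * v j * (2 * pi * space_weight \<beta> (int i - int j)))) {-pi..pi}"
    by (rule has_integral_weight_trig_energy[OF _ space_weight_eq_moment[OF assms(1)]]) simp
  also have "(\<Sum>i=1..M-1. \<Sum>j=1..M-1. v i * v j * (2 * pi * space_weight \<beta> (int i - int j)))
     = 2 * pi * toeplitz_form M (space_weight \<beta>) v v"
    unfolding toeplitz_form_def sum_distrib_left by (intro sum.cong refl) simp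
  finally have I: "((\<lambda>x. space_symbol \<beta> x * ?E x) has_integral
      2 * pi * toeplitz_form M (space_weight \<beta>) v v) {-pi..pi}" .
  have img: "(\<lambda>x. x / h) ` {-pi..pi} = {- pi / h..pi / h}"
    using assms(2) by (simp add: image_divide_atLeastAtMost)
  from has_integral_mult_right[OF has_integral_stretch_real[OF I, of h], of "h powr (- \<beta>) * (h\<^sup>2 / (2 * pi))"] assms(2)
  have J: "((\<lambda>k. h powr (- \<beta>) * (h\<^sup>2 / (2 * pi)) * (space_symbol \<beta> (h * k) * ?E (h * k))) has_integral
      h powr (- \<beta>) * (h * toeplitz_form M (space_weight \<beta>) v v)) {- pi / h..pi / h}"
    unfolding img by (simp add: power2_eq_square field_simps)
  have "(\<lambda>k. \<bar>k\<bar> powr \<beta> * (cmod (grid_fourier h M v k))\<^sup>2) integrable_on {- pi / h..pi / h}"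
    unfolding cmod_grid_fourier_sq[OF assms(2)] trig_energy_def using assms
    by (intro integrable_continuous_real continuous_intros continuous_on_powr') auto
  then have F: "((\<lambda>k. \<bar>k\<bar> powr \<beta> * (cmod (grid_fourier h M v k))\<^sup>2) has_integral frac_seminorm_sq \<beta> h M v) {- pi / h..pi / h}"
    unfolding frac_seminorm_sq_def by (rule integrable_integral)
  show ?thesis
  proof (rule has_integral_le[OF J F])
    fix k
    have "space_symbol \<beta> (h * k) \<le> \<bar>h * k\<bar> powr \<beta>"
      unfolding space_symbol_def using assms by (intro powr_mono2 abs_two_sin_half_le) auto
    also have "\<dots> = h powr \<beta> * \<bar>k\<bar> powr \<beta>"
      using assms by (simp add: abs_mult powr_mult)
    finally have "h powr (- \<beta>) * space_symbol \<beta> (h * k) \<le> h powr (- \<beta>) * (h powr \<beta> * \<bar>k\<bar> powr \<beta>)"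
      by (intro mult_left_mono) auto
    also have "\<dots> = \<bar>k\<bar> powr \<beta>" using assms by (simp add: powr_minus)
    finally have "h powr (- \<beta>) * space_symbol \<beta> (h * k) * (h\<^sup>2 / (2 * pi) * ?E (h * k))
       \<le> \<bar>k\<bar> powr \<beta> * (h\<^sup>2 / (2 * pi) * ?E (h * k))"
      by (intro mult_right_mono) (auto simp: trig_energy_nonneg)
    then show "h powr (- \<beta>) * (h\<^sup>2 / (2 * pi)) * (space_symbol \<beta> (h * k) * ?E (h * k))
       \<le> \<bar>k\<bar> powr \<beta> * (cmod (grid_fourier h M v k))\<^sup>2"
      unfolding cmod_grid_fourier_sq[OF assms(2)] by (simp only: mult_ac)
  qed
qed

section \<open>Energy estimate and discrete Gronwall inequality\<close>

lemma toeplitz_form_polarize: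
  assumes "\<And>k. a (- k) = a k"
  shows "toeplitz_form M a (\<lambda>i. (x i + y i) / 2) (\<lambda>i. (x i - y i) / \<tau>)
    = (toeplitz_form M a x x - toeplitz_form M a y y) / (2 * \<tau>)"
proof -
  have sym: "toeplitz_form M a x y = toeplitz_form M a y x"
    unfolding toeplitz_form_def
    by (subst sum.swap, intro sum.cong refl) (use assms[of "int _ - int _"] in \<open>simp add: mult_ac\<close>)
  have "toeplitz_form M a (\<lambda>i. (x i + y i) / 2) (\<lambda>i. (x i - y i) / \<tau>)
     = (toeplitz_form M a x x - toeplitz_form M a x y + toeplitz_form M a y x - toeplitz_form M a y y) / (2 * \<tau>)"
    unfolding toeplitz_form_def sum_divide_distrib sum.distrib[symmetric] sum_subtractf[symmetric]
    by (intro sum.cong refl) (simp add: field_simps)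
  then show ?thesis unfolding sym by simp
qed

text \<open>
  The memory term \<open>D\<close> is abstract: all that matters is that it does nonnegative work against the time
  differences of \<open>u\<close>.
\<close>

lemma energy_inequality:
  fixes u G D :: "nat \<Rightarrow> nat \<Rightarrow> real"
  assumes \<tau>: "\<tau> > 0" and sym: "\<And>k. a (- k) = a k"
    and memory: "\<And>i. i \<in> {1..M-1} \<Longrightarrow> 0 \<le> (\<Sum>n=1..m. D n i * time_diff \<tau> u n i)"
    and eq: "\<And>n i. n \<in> {1..m} \<Longrightarrow> i \<in> {1..M-1} \<Longrightarrow>
       D n i = - c * (\<Sum>j=1..M-1. a (int i - int j) * time_avg u n j) + G n i"
  shows "c / 2 * (toeplitz_form M a (u m) (u m) - toeplitz_form M a (u 0) (u 0))
      \<le> (\<Sum>i=1..M-1. \<Sum>n=1..m. G n i * (u n i - u (n - 1) i))"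
proof -
  let ?I = "{1..M-1}" and ?S = "\<lambda>v. toeplitz_form M a v v"
  have step: "(\<Sum>i\<in>?I. D n i * time_diff \<tau> u n i)
     = - (c / (2 * \<tau>)) * (?S (u n) - ?S (u (n - 1))) + (\<Sum>i\<in>?I. G n i * (u n i - u (n - 1) i)) / \<tau>"
    if n: "n \<in> {1..m}" for n
  proof -
    have "(\<Sum>i\<in>?I. D n i * time_diff \<tau> u n i)
       = (\<Sum>i\<in>?I. - c * (\<Sum>j\<in>?I. a (int i - int j) * time_avg u n j * time_diff \<tau> u n i)
             + G n i * (u n i - u (n - 1) i) / \<tau>)"
      by (intro sum.cong refl)
         (simp only: eq[OF n] distrib_right mult.assoc[of "- c"] sum_distrib_right, simp add: time_diff_def)
    also have "\<dots> = - c * (\<Sum>i\<in>?I. \<Sum>j\<in>?I. a (int i - int j) * time_avg u n j * time_diff \<tau> u n i)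
        + (\<Sum>i\<in>?I. G n i * (u n i - u (n - 1) i)) / \<tau>"
      unfolding sum.distrib sum_distrib_left[symmetric] sum_divide_distrib ..
    also have "(\<Sum>i\<in>?I. \<Sum>j\<in>?I. a (int i - int j) * time_avg u n j * time_diff \<tau> u n i)
        = toeplitz_form M a (\<lambda>i. (u n i + u (n - 1) i) / 2) (\<lambda>i. (u n i - u (n - 1) i) / \<tau>)"
      unfolding toeplitz_form_def time_avg_def time_diff_def
      by (subst sum.swap, intro sum.cong refl) (use sym[of "int _ - int _"] in simp)
    finally show ?thesis unfolding toeplitz_form_polarize[of a, OF sym] by simp
  qed
  have "0 \<le> (\<Sum>i\<in>?I. \<Sum>n=1..m. D n i * time_diff \<tau> u n i)"
    by (intro sum_nonneg memory)
  also have "\<dots> = (\<Sum>n=1..m. \<Sum>i\<in>?I. D n i * time_diff \<tau> u n i)"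
    by (rule sum.swap)
  also have "\<dots> = (\<Sum>n=1..m. - (c / (2 * \<tau>)) * (?S (u n) - ?S (u (n - 1)))
      + (\<Sum>i\<in>?I. G n i * (u n i - u (n - 1) i)) / \<tau>)"
    by (intro sum.cong refl step)
  also have "\<dots> = - (c / (2 * \<tau>)) * (\<Sum>n=1..m. ?S (u n) - ?S (u (n - 1)))
      + (\<Sum>n=1..m. \<Sum>i\<in>?I. G n i * (u n i - u (n - 1) i)) / \<tau>"
    unfolding sum.distrib sum_distrib_left[symmetric] sum_divide_distrib ..
  also have "(\<Sum>n=1..m. ?S (u n) - ?S (u (n - 1))) = ?S (u m) - ?S (u 0)"
    by (induction m) auto
  also have "(\<Sum>n=1..m. \<Sum>i\<in>?I. G n i * (u n i - u (n - 1) i))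
      = (\<Sum>i\<in>?I. \<Sum>n=1..m. G n i * (u n i - u (n - 1) i))"
    by (rule sum.swap)
  also have "- (c / (2 * \<tau>)) * x + y / \<tau> = (- (c / 2) * x + y) / \<tau>" for x y
    using \<tau> by (simp add: field_simps)
  finally have "0 \<le> (- (c / 2) * (?S (u m) - ?S (u 0)) + (\<Sum>i\<in>?I. \<Sum>n=1..m. G n i * (u n i - u (n - 1) i))) / \<tau>" .
  then show ?thesis using \<tau> by (simp add: zero_le_divide_iff)
qed

lemma summation_by_parts:
  fixes g v :: "nat \<Rightarrow> real"
  assumes "1 \<le> m"
  shows "(\<Sum>n=1..m. g n * (v n - v (n - 1)))
     = g m * v m - g 1 * v 0 - (\<Sum>n=1..m-1. (g (n + 1) - g n) * v n)"
  using assms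
proof (induction m rule: dec_induct)
  case (step m)
  then have "(\<Sum>n=1..Suc m-1. (g (n + 1) - g n) * v n)
     = (\<Sum>n=1..m-1. (g (n + 1) - g n) * v n) + (g (m + 1) - g m) * v m"
    by (cases m) simp_all
  with step show ?case by (simp add: algebra_simps)
qed (simp add: algebra_simps)

lemma grid_norm_sq_nonneg: "0 \<le> h \<Longrightarrow> 0 \<le> grid_norm_sq h M v"
  unfolding grid_norm_sq_def by (intro mult_nonneg_nonneg sum_nonneg) auto

lemma grid_young:
  assumes "0 \<le> h"
  shows "2 * q * (h * (\<Sum>i=1..M-1. v i * w i)) \<le> q\<^sup>2 * grid_norm_sq h M v + grid_norm_sq h M w"
proof -
  have "2 * q * (\<Sum>i=1..M-1. v i * w i) \<le> (\<Sum>i=1..M-1. q\<^sup>2 * (v i)\<^sup>2 + (w i)\<^sup>2)"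
    unfolding sum_distrib_left
  proof (rule sum_mono)
    fix i
    show "2 * q * (v i * w i) \<le> q\<^sup>2 * (v i)\<^sup>2 + (w i)\<^sup>2"
      using sum_squares_bound[of "q * v i" "w i"] by (simp add: power_mult_distrib mult_ac)
  qed
  from mult_left_mono[OF this assms] show ?thesis
    by (simp add: grid_norm_sq_def sum.distrib sum_distrib_left algebra_simps)
qed

lemma discrete_gronwall:
  fixes X :: "nat \<Rightarrow> real"
  assumes "0 \<le> \<tau>" "1 \<le> m"
    and "\<And>n. n \<in> {1..m} \<Longrightarrow> X n \<le> F + \<tau> * (\<Sum>k=1..n-1. X k)"
  shows "X m \<le> (1 + \<tau>) ^ (m - 1) * F"
proof -
  have "n \<le> m \<Longrightarrow> F + \<tau> * (\<Sum>k=1..n-1. X k) \<le> (1 + \<tau>) ^ (n - 1) * F" if "1 \<le> n" for n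
    using that
  proof (induction n rule: dec_induct)
    case (step n)
    then have "F + \<tau> * (\<Sum>k=1..Suc n-1. X k) = (F + \<tau> * (\<Sum>k=1..n-1. X k)) + \<tau> * X n"
      by (cases n) (simp_all add: algebra_simps)
    also have "\<dots> \<le> (1 + \<tau>) * (F + \<tau> * (\<Sum>k=1..n-1. X k))"
      using mult_left_mono[OF assms(3)[of n] assms(1)] step by (simp add: distrib_right)
    also have "\<dots> \<le> (1 + \<tau>) * ((1 + \<tau>) ^ (n - 1) * F)"
      using step assms(1) by (intro mult_left_mono) auto
    also have "\<dots> = (1 + \<tau>) ^ (Suc n - 1) * F"
      using step by (cases n) simp_all
    finally show ?case .
  qed simp
  then show ?thesis using assms(2) assms(3)[of m] by force
qed

text \<open>
  The source is paired with time differences of \<open>u\<close>, which no norm at hand controls; summation by parts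
  leaves only values of \<open>u\<close>. Put \<open>q = 2/(K \<kappa>)\<close>. Young's inequality splits each pairing, scaled by
  \<open>2 q\<close>, into \<open>q\<^sup>2\<close> times a source norm plus a norm of \<open>u\<close>. The one at level \<open>n\<close> is absorbed on the left,
  the one at level \<open>0\<close> raises the factor of \<open>E 0 / \<kappa>\<close> from \<open>2\<close> to \<open>3\<close>, and the others carry a factor
  \<open>\<tau>\<close> and feed the Gronwall inequality.
\<close>

lemma stability_of_energy_inequality:
  fixes u G :: "nat \<Rightarrow> nat \<Rightarrow> real" and E :: "nat \<Rightarrow> real"
  assumes pos: "0 < h" "0 < \<tau>" "0 < K" "0 < \<kappa>" "1 \<le> m"
    and energy: "\<And>n. n \<in> {1..m} \<Longrightarrow>
        K / 2 * (E n - E 0) \<le> h * (\<Sum>i=1..M-1. \<Sum>k=1..n. G k i * (u k i - u (k - 1) i))"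
    and coercive: "\<And>n. \<kappa> * grid_norm_sq h M (u n) \<le> E n"
  shows "grid_norm_sq h M (u m) \<le> exp (\<tau> * real m) *
     (3 / \<kappa> * E 0
      + (2 / (K * \<kappa>))\<^sup>2 * (grid_norm_sq h M (G 1) + (MAX n\<in>{1..m}. grid_norm_sq h M (G n)))
      + (2 / (K * \<kappa>))\<^sup>2 * (\<tau> * (\<Sum>n=1..m-1. grid_norm_sq h M (time_diff \<tau> G (n + 1)))))"
proof -
  let ?X = "\<lambda>v. grid_norm_sq h M v"
  let ?ip = "\<lambda>v w :: nat \<Rightarrow> real. h * (\<Sum>i=1..M-1. v i * w i)"
  define q where "q = 2 / (K * \<kappa>)"
  define mx where "mx = (MAX n\<in>{1..m}. ?X (G n))"
  define F where "F = 3 / \<kappa> * E 0 + q\<^sup>2 * (?X (G 1) + mx) + q\<^sup>2 * (\<tau> * (\<Sum>n=1..m-1. ?X (time_diff \<tau> G (n + 1))))"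
  have X0: "0 \<le> ?X v" for v using pos by (intro grid_norm_sq_nonneg) auto
  have q0: "0 < q" using pos by (simp add: q_def)
  have "?X (u n) \<le> F + \<tau> * (\<Sum>k=1..n-1. ?X (u k))" if n: "n \<in> {1..m}" for n
  proof -
    have parts: "h * (\<Sum>i=1..M-1. \<Sum>k=1..n. G k i * (u k i - u (k - 1) i))
       = ?ip (G n) (u n) - ?ip (G 1) (u 0) - \<tau> * (\<Sum>k=1..n-1. ?ip (time_diff \<tau> G (k + 1)) (u k))"
    proof -
      have "(\<Sum>i=1..M-1. \<Sum>k=1..n. G k i * (u k i - u (k - 1) i))
        = (\<Sum>i=1..M-1. G n i * u n i - G 1 i * u 0 i - \<tau> * (\<Sum>k=1..n-1. time_diff \<tau> G (k + 1) i * u k i))"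
      proof (rule sum.cong[OF refl])
        fix i
        have "(\<Sum>k=1..n-1. (G (k + 1) i - G k i) * u k i) = \<tau> * (\<Sum>k=1..n-1. time_diff \<tau> G (k + 1) i * u k i)"
          unfolding sum_distrib_left using pos by (intro sum.cong refl) (simp add: time_diff_def)
        then show "(\<Sum>k=1..n. G k i * (u k i - u (k - 1) i))
          = G n i * u n i - G 1 i * u 0 i - \<tau> * (\<Sum>k=1..n-1. time_diff \<tau> G (k + 1) i * u k i)"
          using summation_by_parts[of n "\<lambda>k. G k i" "\<lambda>k. u k i"] n by simp
      qed
      also have "\<dots> = (\<Sum>i=1..M-1. G n i * u n i) - (\<Sum>i=1..M-1. G 1 i * u 0 i)
          - \<tau> * (\<Sum>k=1..n-1. \<Sum>i=1..M-1. time_diff \<tau> G (k + 1) i * u k i)"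
        unfolding sum_subtractf sum_distrib_left[symmetric] by (subst sum.swap) rule
      finally show ?thesis
        by (simp add: right_diff_distrib sum_distrib_left mult_ac)
    qed
    have "?X (u n) \<le> E n / \<kappa>"
      using coercive[of n] pos by (simp add: field_simps)
    also have "\<dots> = E 0 / \<kappa> + q * (K / 2 * (E n - E 0))"
      using pos by (simp add: q_def field_simps)
    also have "\<dots> \<le> E 0 / \<kappa> + q * (?ip (G n) (u n) - ?ip (G 1) (u 0) - \<tau> * (\<Sum>k=1..n-1. ?ip (time_diff \<tau> G (k + 1)) (u k)))"
      unfolding parts[symmetric] using q0 by (intro add_left_mono mult_left_mono energy n) auto
    finally have "2 * ?X (u n) \<le> 2 * (E 0 / \<kappa> + q * (?ip (G n) (u n) - ?ip (G 1) (u 0)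
       - \<tau> * (\<Sum>k=1..n-1. ?ip (time_diff \<tau> G (k + 1)) (u k))))"
      by (rule mult_left_mono) simp
    also have "2 * (e + q * (x - y - \<tau> * z)) = 2 * e + 2 * q * x + 2 * (- q) * y + \<tau> * (2 * (- q) * z)"
      for e x y z by (simp add: algebra_simps)
    finally have "2 * ?X (u n) \<le> 2 * (E 0 / \<kappa>) + 2 * q * ?ip (G n) (u n) + 2 * (- q) * ?ip (G 1) (u 0)
       + \<tau> * (\<Sum>k=1..n-1. 2 * (- q) * ?ip (time_diff \<tau> G (k + 1)) (u k))"
      unfolding sum_distrib_left[of "2 * (- q)"] .
    also have "\<dots> \<le> 2 * (E 0 / \<kappa>) + (q\<^sup>2 * ?X (G n) + ?X (u n)) + ((- q)\<^sup>2 * ?X (G 1) + ?X (u 0))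
       + \<tau> * (\<Sum>k=1..n-1. (- q)\<^sup>2 * ?X (time_diff \<tau> G (k + 1)) + ?X (u k))"
      using pos by (intro add_mono mult_left_mono sum_mono grid_young order_refl) auto
    finally have "?X (u n) \<le> 2 * (E 0 / \<kappa>) + ?X (u 0) + q\<^sup>2 * (?X (G 1) + ?X (G n))
       + q\<^sup>2 * (\<tau> * (\<Sum>k=1..n-1. ?X (time_diff \<tau> G (k + 1)))) + \<tau> * (\<Sum>k=1..n-1. ?X (u k))"
      by (simp add: sum.distrib sum_distrib_left algebra_simps)
    moreover have "2 * (E 0 / \<kappa>) + ?X (u 0) \<le> 3 / \<kappa> * E 0"
      using coercive[of 0] pos by (simp add: field_simps)
    moreover have "q\<^sup>2 * (?X (G 1) + ?X (G n)) \<le> q\<^sup>2 * (?X (G 1) + mx)"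
      unfolding mx_def using n by (intro mult_left_mono add_left_mono Max_ge) auto
    moreover have "q\<^sup>2 * (\<tau> * (\<Sum>k=1..n-1. ?X (time_diff \<tau> G (k + 1))))
        \<le> q\<^sup>2 * (\<tau> * (\<Sum>k=1..m-1. ?X (time_diff \<tau> G (k + 1))))"
      using n pos by (intro mult_left_mono sum_mono2 X0) auto
    ultimately show ?thesis unfolding F_def by linarith
  qed
  from discrete_gronwall[OF _ pos(5) this] pos have "?X (u m) \<le> (1 + \<tau>) ^ (m - 1) * F" by simp
  also have "\<dots> \<le> exp (\<tau> * real m) * F"
  proof (rule mult_right_mono)
    have "(1 + \<tau>) ^ (m - 1) \<le> (1 + \<tau>) ^ m" using pos by (intro power_increasing) auto
    also have "\<dots> \<le> exp \<tau> ^ m" using pos by (intro power_mono exp_ge_add_one_self) auto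
    finally show "(1 + \<tau>) ^ (m - 1) \<le> exp (\<tau> * real m)" by (simp add: exp_of_nat2_mult)
    have "0 \<le> E 0" using coercive[of 0] X0[of "u 0"] pos by (meson mult_nonneg_nonneg less_imp_le order_trans)
    moreover have "0 \<le> mx"
      unfolding mx_def using pos(5) X0[of "G 1"] by (intro order_trans[OF X0[of "G 1"] Max_ge]) auto
    ultimately show "0 \<le> F"
      unfolding F_def using pos X0 by (intro add_nonneg_nonneg mult_nonneg_nonneg sum_nonneg) auto
  qed
  finally show ?thesis unfolding F_def mx_def q_def .
qed

section \<open>Stability of the difference scheme\<close>

text \<open>
  The convolution in the scheme also reaches the two boundary nodes, where the grid function vanishes.
\<close>

lemma sum_convolution_zero_boundary:
  assumes "i \<in> {1..M-1}" "v 0 = (0::real)" "v M = 0"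
  shows "(\<Sum>k = int i - int M..int i. a k * v (nat (int i - k))) = (\<Sum>j=1..M-1. a (int i - int j) * v j)"
proof -
  have "(\<Sum>k = int i - int M..int i. a k * v (nat (int i - k))) = (\<Sum>j=0..M. a (int i - int j) * v j)"
    by (rule sum.reindex_bij_witness[where i = "\<lambda>j. int i - int j" and j = "\<lambda>k. nat (int i - k)"]) auto
  also have "\<dots> = (\<Sum>j=1..M-1. a (int i - int j) * v j)"
  proof (rule sum.mono_neutral_right)
    show "\<forall>j\<in>{0..M} - {1..M-1}. a (int i - int j) * v j = 0"
    proof
      fix j assume "j \<in> {0..M} - {1..M-1}"
      then have "j = 0 \<or> j = M" by auto
      then show "a (int i - int j) * v j = 0" using assms by auto
    qed
  qed auto
  finally show ?thesis .
qed

lemma distributed_order_memory_nonneg: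
  fixes v :: "nat \<Rightarrow> real"
  assumes "weight_function \<omega>" "J > 0"
  shows "0 \<le> (\<Sum>n=1..m. (order_step J * (\<Sum>l=0..2*J. trapezoid_coeff J l * \<omega> (order_node J l)
          * (1 / \<tau> powr gamma_node J l)
          * (\<Sum>k=0..n-1. lambda_weight (gamma_node J l) k * v (n - k)))) * v n)" (is "0 \<le> ?form")
proof -
  let ?w = "\<lambda>l. trapezoid_coeff J l * \<omega> (order_node J l) * (1 / \<tau> powr gamma_node J l)"
  have "(\<Sum>n=1..m. (order_step J * (\<Sum>l=0..2*J. ?w l * (\<Sum>k=0..n-1. lambda_weight (gamma_node J l) k * v (n - k)))) * v n)
     = (\<Sum>n=1..m. \<Sum>l=0..2*J. order_step J * (?w l * (\<Sum>k=0..n-1. lambda_weight (gamma_node J l) k * v (n - k) * v n)))"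
    by (simp add: sum_distrib_left sum_distrib_right mult_ac)
  also have "\<dots> = (\<Sum>l=0..2*J. order_step J * (?w l * (\<Sum>n=1..m. \<Sum>k=0..n-1. lambda_weight (gamma_node J l) k * v (n - k) * v n)))"
    by (subst sum.swap) (simp add: sum_distrib_left)
  finally have eq: "?form = (\<Sum>l=0..2*J. order_step J * (?w l * (\<Sum>n=1..m. \<Sum>k=0..n-1. lambda_weight (gamma_node J l) k * v (n - k) * v n)))" .
  show ?thesis
    unfolding eq
  proof (rule sum_nonneg, intro mult_nonneg_nonneg)
    fix l assume l: "l \<in> {0..2*J}"
    have g: "0 \<le> gamma_node J l" "gamma_node J l \<le> 1"
      using l assms(2) by (auto simp: gamma_node_def order_node_def order_step_def field_simps)
    then have "order_node J l \<in> {1..2}" by (simp add: gamma_node_def)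
    then show "0 \<le> \<omega> (order_node J l)" using assms(1) by (simp add: weight_function_def)
    show "0 \<le> (\<Sum>n=1..m. \<Sum>k=0..n-1. lambda_weight (gamma_node J l) k * v (n - k) * v n)"
      by (rule lambda_weight_form_nonneg[OF g])
  qed (auto simp: order_step_def trapezoid_coeff_def)
qed

theorem theorem3p2:
  fixes \<beta> K L T h \<tau> :: real and M N J m :: nat
    and \<omega> :: "real \<Rightarrow> real"
    and G :: "nat \<Rightarrow> nat \<Rightarrow> real" and \<phi> :: "nat \<Rightarrow> real"
    and u :: "nat \<Rightarrow> nat \<Rightarrow> real"
  assumes "1 < \<beta>" "\<beta> \<le> 2" "K > 0" "L > 0" "T > 0" "M > 0" "N > 0" "J > 0"
    and h: "h = L / real M" and tau: "\<tau> = T / real N"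
    and weight: "weight_function \<omega>"
    and scheme: "\<And>i n. \<lbrakk>1 \<le> i; i \<le> M - 1; 1 \<le> n; n \<le> N\<rbrakk> \<Longrightarrow>
      order_step J * (\<Sum>l=0..2*J. trapezoid_coeff J l * \<omega> (order_node J l)
          * (1 / \<tau> powr gamma_node J l)
          * (\<Sum>k=0..n-1. lambda_weight (gamma_node J l) k * time_diff \<tau> u (n - k) i))
        = - K * h powr (- \<beta>)
            * (\<Sum>k = int i - int M..int i. space_weight \<beta> k * time_avg u n (nat (int i - k)))
          + G n i"
    and initial: "\<And>i. \<lbrakk>1 \<le> i; i \<le> M - 1\<rbrakk> \<Longrightarrow> u 0 i = \<phi> i"
    and boundary: "\<And>n. n \<le> N \<Longrightarrow> u n 0 = 0 \<and> u n M = 0"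
    and m: "1 \<le> m" "m \<le> N"
  shows "ereal (grid_norm_sq h M (u m)) \<le>
    ereal (exp T) *
      (ereal (3 * L powr \<beta>) / ereal (c_star \<beta>) * ereal (frac_seminorm_sq \<beta> h M (u 0))
       + (ereal (2 * L powr \<beta>) / ereal (K * c_star \<beta>))\<^sup>2
         * ereal (grid_norm_sq h M (G 1) + (MAX n\<in>{1..m}. grid_norm_sq h M (G n)))
       + (ereal (2 * L powr \<beta>) / ereal (K * c_star \<beta>))\<^sup>2
         * ereal (\<tau> * (\<Sum>n=1..m-1. grid_norm_sq h M (time_diff \<tau> G (n + 1)))))"
proof -
  have h0: "0 < h" and \<tau>0: "0 < \<tau>" and \<beta>0: "0 < \<beta>"
    using assms(1-8) by (simp_all add: h tau)
  let ?X = "\<lambda>v. grid_norm_sq h M v" and ?S = "\<lambda>v. toeplitz_form M (space_weight \<beta>) v v"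
  define s where "s = frac_seminorm_sq \<beta> h M (u 0)"
  define g where "g = ?X (G 1) + (MAX n\<in>{1..m}. ?X (G n))"
  define d where "d = \<tau> * (\<Sum>n=1..m-1. ?X (time_diff \<tau> G (n + 1)))"
  have X0: "0 \<le> ?X v" for v using h0 by (intro grid_norm_sq_nonneg) auto
  have Xmax: "?X (G n) \<le> (MAX n\<in>{1..m}. ?X (G n))" if "n \<in> {1..m}" for n
    using that by (intro Max_ge) auto
  have d0: "0 \<le> d" unfolding d_def using \<tau>0 X0 by (intro mult_nonneg_nonneg sum_nonneg) auto
  have g0: "0 \<le> g" 
  proof -
    have "1 \<in> {1..m}" using m by simp
    from Xmax[OF this] X0[of "G 1"] show ?thesis unfolding g_def by linarith
  qed
  define E where "E = (\<lambda>n. h powr (- \<beta>) * (h * ?S (u n)))"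
  have E0: "E 0 \<le> s" unfolding E_def s_def by (rule space_form_le_seminorm[OF assms(1) h0])
  have energy: "K / 2 * (E n - E 0) \<le> h * (\<Sum>i=1..M-1. \<Sum>k=1..n. G k i * (u k i - u (k - 1) i))"
    if n: "n \<in> {1..m}" for n
  proof -
    have "K * h powr (- \<beta>) / 2 * (?S (u n) - ?S (u 0)) \<le> (\<Sum>i=1..M-1. \<Sum>k=1..n. G k i * (u k i - u (k - 1) i))"
    proof (rule energy_inequality[where a = "space_weight \<beta>", OF \<tau>0 space_weight_uminus])
      fix k i assume k: "k \<in> {1..n}" and i: "i \<in> {1..M-1}"
      have "time_avg u k 0 = 0" "time_avg u k M = 0"
        using boundary[of k] boundary[of "k - 1"] k n m by (auto simp: time_avg_def)
      from sum_convolution_zero_boundary[OF i, where v = "time_avg u k", OF this] scheme[of i k] k n m i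
      show "order_step J * (\<Sum>l=0..2*J. trapezoid_coeff J l * \<omega> (order_node J l)
          * (1 / \<tau> powr gamma_node J l)
          * (\<Sum>k'=0..k-1. lambda_weight (gamma_node J l) k' * time_diff \<tau> u (k - k') i))
        = - (K * h powr (- \<beta>)) * (\<Sum>j=1..M-1. space_weight \<beta> (int i - int j) * time_avg u k j) + G k i"
        by simp
    qed (rule distributed_order_memory_nonneg[OF weight \<open>J > 0\<close>])
    from mult_left_mono[OF this, of h] h0 show ?thesis
      by (simp add: E_def right_diff_distrib mult_ac)
  qed
  \<comment> \<open>Vanishing data give a vanishing solution; this is what remains to be shown for \<open>\<beta> = 2\<close>.\<close>
  have Xs: "?X (u m) = 0" if "s \<le> 0" "g \<le> 0"
  proof -
    have zero: "G k i = 0" if k: "k \<in> {1..m}" and i: "i \<in> {1..M-1}" for k i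
    proof -
      have "?X (G k) = 0" using Xmax[OF k] X0[of "G k"] X0[of "G 1"] \<open>g \<le> 0\<close> unfolding g_def by linarith
      then have "(\<Sum>i=1..M-1. (G k i)\<^sup>2) = 0" using h0 by (simp add: grid_norm_sq_def)
      then show ?thesis using i by (subst (asm) sum_nonneg_eq_0_iff) auto
    qed
    have "K / 2 * (E m - E 0) \<le> 0"
      using energy[of m] m zero by simp
    then have "E m \<le> E 0" using \<open>K > 0\<close> by (simp add: mult_le_0_iff)
    then have "h powr (- \<beta>) * (h * ?S (u m)) \<le> 0" using E0 \<open>s \<le> 0\<close> unfolding E_def by linarith
    then have "?S (u m) \<le> 0" using h0 by (simp add: mult_le_0_iff)
    from space_form_definite[OF \<beta>0 assms(2) this] show ?thesis by (simp add: grid_norm_sq_def)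
  qed
  have hL: "h powr (- \<beta>) * real M powr (- \<beta>) = L powr (- \<beta>)"
    unfolding powr_mult[symmetric] using \<open>M > 0\<close> by (simp add: h)
  have coercive: "c_star \<beta> * L powr (- \<beta>) * ?X v \<le> h powr (- \<beta>) * (h * ?S v)" for v
    unfolding hL[symmetric] grid_norm_sq_def
    using mult_left_mono[OF space_form_coercive[OF \<beta>0 assms(2), of M v], of "h powr (- \<beta>) * h"] h0
    by (simp add: mult_ac)
  show ?thesis
  proof (cases "\<beta> = 2")
    case False
    then have c: "0 < c_star \<beta>" using assms(2) \<beta>0 by (intro c_star_pos) auto
    define \<kappa> where "\<kappa> = c_star \<beta> * L powr (- \<beta>)"
    have \<kappa>: "0 < \<kappa>" using c \<open>L > 0\<close> by (simp add: \<kappa>_def)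
    have E0_nonneg: "0 \<le> E 0"
      using coercive[of "u 0"] \<kappa> X0[of "u 0"] unfolding E_def \<kappa>_def
      by (meson mult_nonneg_nonneg less_imp_le order_trans)
    have "?X (u m) \<le> exp (\<tau> * real m) * (3 / \<kappa> * E 0 + (2 / (K * \<kappa>))\<^sup>2 * g + (2 / (K * \<kappa>))\<^sup>2 * d)"
      unfolding g_def d_def
      by (rule stability_of_energy_inequality[OF h0 \<tau>0 \<open>K > 0\<close> \<kappa> m(1) energy])
         (use coercive in \<open>auto simp: \<kappa>_def E_def\<close>)
    also have "\<dots> \<le> exp T * (3 / \<kappa> * s + (2 / (K * \<kappa>))\<^sup>2 * g + (2 / (K * \<kappa>))\<^sup>2 * d)"
    proof (intro mult_mono add_mono order_refl)
      have "\<tau> * real m \<le> \<tau> * real N" using m \<tau>0 by (intro mult_left_mono) auto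
      also have "\<dots> = T" using \<open>N > 0\<close> by (simp add: tau)
      finally show "exp (\<tau> * real m) \<le> exp T" by simp
      show "0 \<le> 3 / \<kappa> * E 0 + (2 / (K * \<kappa>))\<^sup>2 * g + (2 / (K * \<kappa>))\<^sup>2 * d"
        using \<kappa> d0 g0 E0_nonneg by simp
    qed (use \<kappa> E0 E0_nonneg g0 d0 in auto)
    also have "3 / \<kappa> = 3 * L powr \<beta> / c_star \<beta>"
      unfolding \<kappa>_def by (simp add: powr_minus field_simps)
    also have "2 / (K * \<kappa>) = 2 * L powr \<beta> / (K * c_star \<beta>)"
      unfolding \<kappa>_def by (simp add: powr_minus field_simps)
    finally show ?thesis
      using c \<open>K > 0\<close> unfolding s_def[symmetric] g_def[symmetric] d_def[symmetric] by simp
  next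
    case True
    have c: "c_star \<beta> = 0" using True c_star_2 by simp
    have L: "0 < L powr \<beta>" using \<open>L > 0\<close> by simp
    have s0: "0 \<le> s"
      using coercive[of "u 0"] E0 unfolding c E_def by simp
    show ?thesis
      unfolding s_def[symmetric] g_def[symmetric] d_def[symmetric] c
    proof (cases "s = 0 \<and> g = 0")
      case True
      then have "?X (u m) = 0" using Xs by simp
      then show "ereal (?X (u m)) \<le> ereal (exp T) * (ereal (3 * L powr \<beta>) / ereal 0 * ereal s
         + (ereal (2 * L powr \<beta>) / ereal (K * 0))\<^sup>2 * ereal g + (ereal (2 * L powr \<beta>) / ereal (K * 0))\<^sup>2 * ereal d)"
        using s0 g0 d0 L by simp
    next
      case False
      \<comment> \<open>At least one of \<open>s\<close> and \<open>g\<close> is positive, so one summand of the bound is infinite.\<close>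
      have inf: "ereal (3 * L powr \<beta>) / ereal 0 = \<infinity>" "ereal (2 * L powr \<beta>) / ereal (K * 0) = \<infinity>"
        using L by (simp_all add: divide_ereal_def)
      have inf_sum: "\<infinity> * ereal s + \<infinity>\<^sup>2 * ereal g + \<infinity>\<^sup>2 * ereal d = \<infinity>"
        using False s0 g0 d0 by (cases "s = 0"; cases "g = 0"; cases "d = 0") (auto simp: power2_eq_square)
      then show "ereal (?X (u m)) \<le> ereal (exp T) * (ereal (3 * L powr \<beta>) / ereal 0 * ereal s
         + (ereal (2 * L powr \<beta>) / ereal (K * 0))\<^sup>2 * ereal g + (ereal (2 * L powr \<beta>) / ereal (K * 0))\<^sup>2 * ereal d)"
        unfolding inf inf_sum by simp
    qed
  qed
qed

end
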